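(* Let $(M^n,g)$ be a complete Riemannian spin manifold without boundary and let $f\in C^\infty(M)$. The square of the weighted Dirac operator $D_f$ satisfies $$D_f^2=-\Delta_f+\frac14\,\mathrm{R}_f$$ as operators on smooth spinors.
   Context: $\Sigma M\to M$ is the complex spinor bundle with its Hermitian metric, Clifford multiplication $\cdot$ (convention $X\cdot Y\cdot\psi+Y\cdot X\cdot\psi=-2g(X,Y)\psi$), and spin connection $\nabla$ induced by the Levi-Civita connection. In a local orthonormal frame the Dirac operator is $D=\sum_i e_i\cdot\nabla_{e_i}$; the weighted Dirac operator is $D_f\psi=D\psi-\frac12(\nabla f)\cdot\psi$. $\Delta=\mathrm{tr}\,\nabla^2=-\nabla^*\nabla$ on spinors, and $\Delta=\mathrm{tr}\nabla^2$ on functions. The weighted Laplacian on spinors is $\Delta_f=\Delta-\nabla_{\nabla f}$. The weighted scalar curvature is $\mathrm{R}_f=\mathrm{R}+2\Delta f-|\nabla f|^2$, where $\mathrm{R}$ is the scalar curvature of $g$. *)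

theory Defs
  imports "HOL-Analysis.Analysis"
begin

text \<open>
  A manifold is a type \<open>'m\<close> carrying a topology together with an atlas of charts into
  \<open>real ^ 'n\<close>, so the dimension is \<open>CARD('n)\<close>.  Functions and vector fields are
  total; what they do outside the open set under consideration is irrelevant.
\<close>


section \<open>Smooth manifolds\<close>

text \<open>Only meant for open \<open>S\<close>: continuous partial derivatives up to order \<open>k\<close>.\<close>

primrec Ck_on :: "nat \<Rightarrow> ('a::euclidean_space \<Rightarrow> 'b::real_normed_vector) \<Rightarrow> 'a set \<Rightarrow> bool" where
  "Ck_on 0 h S \<longleftrightarrow> continuous_on S h"
| "Ck_on (Suc k) h S \<longleftrightarrow>
     (\<forall>x\<in>S. h differentiable (at x)) \<and>
     (\<forall>v\<in>Basis. Ck_on k (\<lambda>x. frechet_derivative h (at x) v) S)"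

definition Cinf_on :: "('a::euclidean_space \<Rightarrow> 'b::real_normed_vector) \<Rightarrow> 'a set \<Rightarrow> bool" where
  "Cinf_on h S \<longleftrightarrow> (\<forall>k. Ck_on k h S)"

type_synonym ('m, 'n) chart = "'m set \<times> ('m \<Rightarrow> real ^ 'n)"

definition smooth_manifold ::
    "('m::{t2_space, second_countable_topology}, 'n::finite) chart set \<Rightarrow> bool" where
  "smooth_manifold \<A> \<longleftrightarrow>
     (\<Union>(V, \<phi>)\<in>\<A>. V) = UNIV \<and>
     (\<forall>(V, \<phi>)\<in>\<A>. open V \<and> open (\<phi> ` V) \<and> homeomorphism V (\<phi> ` V) \<phi> (inv_into V \<phi>)) \<and>
     (\<forall>(V, \<phi>)\<in>\<A>. \<forall>(V', \<phi>')\<in>\<A>. Cinf_on (\<phi>' \<circ> inv_into V \<phi>) (\<phi> ` (V \<inter> V')))"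

definition smooth_fun_on ::
    "('m::topological_space, 'n::finite) chart set \<Rightarrow> 'm set \<Rightarrow> ('m \<Rightarrow> real) \<Rightarrow> bool" where
  "smooth_fun_on \<A> U h \<longleftrightarrow> (\<forall>(V, \<phi>)\<in>\<A>. Cinf_on (h \<circ> inv_into V \<phi>) (\<phi> ` (U \<inter> V)))"

definition smooth_near ::
    "('m::topological_space, 'n::finite) chart set \<Rightarrow> 'm \<Rightarrow> ('m \<Rightarrow> real) \<Rightarrow> bool" where
  "smooth_near \<A> x h \<longleftrightarrow> (\<exists>U. open U \<and> x \<in> U \<and> smooth_fun_on \<A> U h)"


section \<open>Tangent vectors and vector fields\<close>

type_synonym 'm tvec = "('m \<Rightarrow> real) \<Rightarrow> real"
type_synonym 'm vfield = "'m \<Rightarrow> 'm tvec"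

text \<open>
  Tangent vectors at \<open>x\<close> are the derivations of germs at \<open>x\<close> of smooth functions.  They
  are given the value 0 on functions that are not smooth near \<open>x\<close>, so that equality of
  tangent vectors is equality of functions.
\<close>

definition tangent_space ::
    "('m::topological_space, 'n::finite) chart set \<Rightarrow> 'm \<Rightarrow> 'm tvec set" where
  "tangent_space \<A> x = {v.
     (\<forall>h. \<not> smooth_near \<A> x h \<longrightarrow> v h = 0) \<and>
     (\<forall>h k. smooth_near \<A> x h \<and> smooth_near \<A> x k \<and> (\<forall>\<^sub>F y in nhds x. h y = k y) \<longrightarrow> v h = v k) \<and>
     (\<forall>h k. smooth_near \<A> x h \<and> smooth_near \<A> x k \<longrightarrow> v (\<lambda>y. h y + k y) = v h + v k) \<and>
     (\<forall>c h. smooth_near \<A> x h \<longrightarrow> v (\<lambda>y. c * h y) = c * v h) \<and>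
     (\<forall>h k. smooth_near \<A> x h \<and> smooth_near \<A> x k \<longrightarrow>
        v (\<lambda>y. h y * k y) = v h * k x + h x * v k)}"

definition smooth_vfield_on ::
    "('m::topological_space, 'n::finite) chart set \<Rightarrow> 'm set \<Rightarrow> 'm vfield \<Rightarrow> bool" where
  "smooth_vfield_on \<A> U X \<longleftrightarrow>
     (\<forall>x\<in>U. X x \<in> tangent_space \<A> x) \<and>
     (\<forall>W h. open W \<and> W \<subseteq> U \<and> smooth_fun_on \<A> W h \<longrightarrow> smooth_fun_on \<A> W (\<lambda>x. X x h))"

definition lie_bracket ::
    "('m::topological_space, 'n::finite) chart set \<Rightarrow> 'm vfield \<Rightarrow> 'm vfield \<Rightarrow> 'm vfield" where
  "lie_bracket \<A> X Y = (\<lambda>x h. if smooth_near \<A> x h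
     then X x (\<lambda>y. Y y h) - Y x (\<lambda>y. X y h) else 0)"


section \<open>Riemannian metrics, distance and completeness\<close>

type_synonym 'm metric = "'m \<Rightarrow> 'm tvec \<Rightarrow> 'm tvec \<Rightarrow> real"

definition riemannian_metric ::
    "('m::topological_space, 'n::finite) chart set \<Rightarrow> 'm metric \<Rightarrow> bool" where
  "riemannian_metric \<A> g \<longleftrightarrow>
     (\<forall>x. \<forall>v\<in>tangent_space \<A> x. \<forall>w\<in>tangent_space \<A> x. g x v w = g x w v) \<and>
     (\<forall>x. \<forall>u\<in>tangent_space \<A> x. \<forall>v\<in>tangent_space \<A> x. \<forall>w\<in>tangent_space \<A> x.
        g x (\<lambda>h. u h + v h) w = g x u w + g x v w) \<and>
     (\<forall>x c. \<forall>v\<in>tangent_space \<A> x. \<forall>w\<in>tangent_space \<A> x.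
        g x (\<lambda>h. c * v h) w = c * g x v w) \<and>
     (\<forall>x. \<forall>v\<in>tangent_space \<A> x. v \<noteq> (\<lambda>h. 0) \<longrightarrow> g x v v > 0) \<and>
     (\<forall>U X Y. open U \<and> smooth_vfield_on \<A> U X \<and> smooth_vfield_on \<A> U Y \<longrightarrow>
        smooth_fun_on \<A> U (\<lambda>x. g x (X x) (Y x)))"

definition piecewise_C1_curve ::
    "('m::topological_space, 'n::finite) chart set \<Rightarrow> (real \<Rightarrow> 'm) \<Rightarrow> bool" where
  "piecewise_C1_curve \<A> c \<longleftrightarrow> continuous_on {0..1} c \<and>
     (\<forall>(V, \<phi>)\<in>\<A>. \<forall>a b. 0 \<le> a \<and> a \<le> b \<and> b \<le> 1 \<and> c ` {a..b} \<subseteq> V \<longrightarrow>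
        (\<phi> \<circ> c) piecewise_C1_differentiable_on {a..b})"

definition velocity ::
    "('m::topological_space, 'n::finite) chart set \<Rightarrow> (real \<Rightarrow> 'm) \<Rightarrow> real \<Rightarrow> 'm tvec" where
  "velocity \<A> c t = (\<lambda>h. if smooth_near \<A> (c t) h then deriv (h \<circ> c) t else 0)"

definition curve_length ::
    "('m::topological_space, 'n::finite) chart set \<Rightarrow> 'm metric \<Rightarrow> (real \<Rightarrow> 'm) \<Rightarrow> ennreal" where
  "curve_length \<A> g c =
     (\<integral>\<^sup>+t\<in>{0..1}. ennreal (sqrt (g (c t) (velocity \<A> c t) (velocity \<A> c t))) \<partial>lborel)"

text \<open>The distance is infinite between different connected components.\<close>

definition riemannian_dist ::
    "('m::topological_space, 'n::finite) chart set \<Rightarrow> 'm metric \<Rightarrow> 'm \<Rightarrow> 'm \<Rightarrow> ennreal" where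
  "riemannian_dist \<A> g x y =
     (INF c\<in>{c. piecewise_C1_curve \<A> c \<and> c 0 = x \<and> c 1 = y}. curve_length \<A> g c)"

definition complete_metric ::
    "('m::topological_space, 'n::finite) chart set \<Rightarrow> 'm metric \<Rightarrow> bool" where
  "complete_metric \<A> g \<longleftrightarrow>
     (\<forall>s :: nat \<Rightarrow> 'm.
        (\<forall>\<epsilon>>0. \<exists>N. \<forall>k\<ge>N. \<forall>l\<ge>N. riemannian_dist \<A> g (s k) (s l) < \<epsilon>) \<longrightarrow>
        (\<exists>x. (\<lambda>k. riemannian_dist \<A> g (s k) x) \<longlonglongrightarrow> 0))"


section \<open>Orthonormal frames, traces and the Levi-Civita connection\<close>

definition orthonormal_frame ::
    "('m::topological_space, 'n::finite) chart set \<Rightarrow> 'm metric \<Rightarrow> 'm set \<Rightarrow> ('n \<Rightarrow> 'm vfield) \<Rightarrow> bool" where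
  "orthonormal_frame \<A> g U e \<longleftrightarrow> open U \<and>
     (\<forall>a. smooth_vfield_on \<A> U (e a)) \<and>
     (\<forall>x\<in>U. \<forall>a b. g x (e a x) (e b x) = (if a = b then 1 else 0)) \<and>
     (\<forall>x\<in>U. \<forall>v\<in>tangent_space \<A> x. \<exists>c. v = (\<lambda>h. \<Sum>a\<in>UNIV. c a * e a x h))"

text \<open>
  The metric trace at \<open>x\<close> of a bilinear form \<open>B\<close> presented on vector fields (the value
  at \<open>x\<close> being already taken): the common value of the sums over all orthonormal frames
  near \<open>x\<close>.
\<close>

definition metric_trace ::
    "('m::topological_space, 'n::finite) chart set \<Rightarrow> 'm metric \<Rightarrow> 'm \<Rightarrow>
     ('m vfield \<Rightarrow> 'm vfield \<Rightarrow> 'b::comm_monoid_add) \<Rightarrow> 'b" where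
  "metric_trace \<A> g x B =
     (THE r. \<forall>U e. orthonormal_frame \<A> g U e \<and> x \<in> U \<longrightarrow> r = (\<Sum>a\<in>UNIV. B (e a) (e a)))"

type_synonym 'm connection = "'m vfield \<Rightarrow> 'm vfield \<Rightarrow> 'm vfield"

text \<open>
  Connections act on vector fields over arbitrary open sets, compatibly with restriction.
\<close>

definition affine_connection ::
    "('m::topological_space, 'n::finite) chart set \<Rightarrow> 'm connection \<Rightarrow> bool" where
  "affine_connection \<A> nabla \<longleftrightarrow> (\<forall>U. open U \<longrightarrow>
     (\<forall>X Y. smooth_vfield_on \<A> U X \<and> smooth_vfield_on \<A> U Y \<longrightarrow>
        smooth_vfield_on \<A> U (nabla X Y)) \<and>
     (\<forall>X X' Y Y'. smooth_vfield_on \<A> U X \<and> smooth_vfield_on \<A> U Y \<and>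
        (\<forall>x\<in>U. X' x = X x \<and> Y' x = Y x) \<longrightarrow> (\<forall>x\<in>U. nabla X' Y' x = nabla X Y x)) \<and>
     (\<forall>X X' Y. smooth_vfield_on \<A> U X \<and> smooth_vfield_on \<A> U X' \<and> smooth_vfield_on \<A> U Y \<longrightarrow>
        (\<forall>x\<in>U. nabla (\<lambda>y h. X y h + X' y h) Y x = (\<lambda>h. nabla X Y x h + nabla X' Y x h))) \<and>
     (\<forall>k X Y. smooth_fun_on \<A> U k \<and> smooth_vfield_on \<A> U X \<and> smooth_vfield_on \<A> U Y \<longrightarrow>
        (\<forall>x\<in>U. nabla (\<lambda>y h. k y * X y h) Y x = (\<lambda>h. k x * nabla X Y x h))) \<and>
     (\<forall>X Y Y'. smooth_vfield_on \<A> U X \<and> smooth_vfield_on \<A> U Y \<and> smooth_vfield_on \<A> U Y' \<longrightarrow>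
        (\<forall>x\<in>U. nabla X (\<lambda>y h. Y y h + Y' y h) x = (\<lambda>h. nabla X Y x h + nabla X Y' x h))) \<and>
     (\<forall>k X Y. smooth_fun_on \<A> U k \<and> smooth_vfield_on \<A> U X \<and> smooth_vfield_on \<A> U Y \<longrightarrow>
        (\<forall>x\<in>U. nabla X (\<lambda>y h. k y * Y y h) x = (\<lambda>h. X x k * Y x h + k x * nabla X Y x h))))"

definition levi_civita ::
    "('m::topological_space, 'n::finite) chart set \<Rightarrow> 'm metric \<Rightarrow> 'm connection \<Rightarrow> bool" where
  "levi_civita \<A> g nabla \<longleftrightarrow> affine_connection \<A> nabla \<and>
     (\<forall>U X Y. open U \<and> smooth_vfield_on \<A> U X \<and> smooth_vfield_on \<A> U Y \<longrightarrow>
        (\<forall>x\<in>U. (\<lambda>h. nabla X Y x h - nabla Y X x h) = lie_bracket \<A> X Y x)) \<and>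
     (\<forall>U X Y Z. open U \<and> smooth_vfield_on \<A> U X \<and> smooth_vfield_on \<A> U Y \<and>
          smooth_vfield_on \<A> U Z \<longrightarrow>
        (\<forall>x\<in>U. X x (\<lambda>y. g y (Y y) (Z y)) = g x (nabla X Y x) (Z x) + g x (Y x) (nabla X Z x)))"

definition gradient ::
    "('m::topological_space, 'n::finite) chart set \<Rightarrow> 'm metric \<Rightarrow> ('m \<Rightarrow> real) \<Rightarrow> 'm vfield" where
  "gradient \<A> g f x =
     (THE v. v \<in> tangent_space \<A> x \<and> (\<forall>w\<in>tangent_space \<A> x. g x v w = w f))"

definition hessian ::
    "'m connection \<Rightarrow> ('m \<Rightarrow> real) \<Rightarrow> 'm vfield \<Rightarrow> 'm vfield \<Rightarrow> 'm \<Rightarrow> real" where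
  "hessian nabla f X Y x = X x (\<lambda>y. Y y f) - nabla X Y x f"

definition laplacian ::
    "('m::topological_space, 'n::finite) chart set \<Rightarrow> 'm metric \<Rightarrow> 'm connection \<Rightarrow>
     ('m \<Rightarrow> real) \<Rightarrow> 'm \<Rightarrow> real" where
  "laplacian \<A> g nabla f x = metric_trace \<A> g x (\<lambda>X Y. hessian nabla f X Y x)"

definition curvature ::
    "('m::topological_space, 'n::finite) chart set \<Rightarrow> 'm connection \<Rightarrow>
     'm vfield \<Rightarrow> 'm vfield \<Rightarrow> 'm vfield \<Rightarrow> 'm vfield" where
  "curvature \<A> nabla X Y Z =
     (\<lambda>x h. nabla X (nabla Y Z) x h - nabla Y (nabla X Z) x h - nabla (lie_bracket \<A> X Y) Z x h)"

definition ricci ::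
    "('m::topological_space, 'n::finite) chart set \<Rightarrow> 'm metric \<Rightarrow> 'm connection \<Rightarrow>
     'm vfield \<Rightarrow> 'm vfield \<Rightarrow> 'm \<Rightarrow> real" where
  "ricci \<A> g nabla Y Z x =
     metric_trace \<A> g x (\<lambda>V W. g x (curvature \<A> nabla V Y Z x) (W x))"

definition scalar_curvature ::
    "('m::topological_space, 'n::finite) chart set \<Rightarrow> 'm metric \<Rightarrow> 'm connection \<Rightarrow> 'm \<Rightarrow> real" where
  "scalar_curvature \<A> g nabla x = metric_trace \<A> g x (\<lambda>Y Z. ricci \<A> g nabla Y Z x)"

definition weighted_scalar_curvature ::
    "('m::topological_space, 'n::finite) chart set \<Rightarrow> 'm metric \<Rightarrow> 'm connection \<Rightarrow>
     ('m \<Rightarrow> real) \<Rightarrow> 'm \<Rightarrow> real" where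
  "weighted_scalar_curvature \<A> g nabla f x =
     scalar_curvature \<A> g nabla x + 2 * laplacian \<A> g nabla f x
       - g x (gradient \<A> g f x) (gradient \<A> g f x)"


section \<open>The spin group and spin structures\<close>

text \<open>
  \<open>\<gamma> a\<close> is Clifford multiplication by the \<open>a\<close>-th standard basis vector of
  \<open>real ^ 'n\<close> on the complex spinor module.  A complex Clifford module of dimension
  \<open>2 ^ (n div 2)\<close> is automatically irreducible.  Skew-Hermitian matrices make Clifford
  multiplication compatible with the standard Hermitian metric on the fibres.
\<close>

definition spinor_representation :: "('n::finite \<Rightarrow> complex ^ 's ^ 's::finite) \<Rightarrow> bool" where
  "spinor_representation \<gamma> \<longleftrightarrow>
     CARD('s) = 2 ^ (CARD('n) div 2) \<and>
     (\<forall>a b. \<gamma> a ** \<gamma> b + \<gamma> b ** \<gamma> a = (if a = b then (- 2) *\<^sub>R mat 1 else 0)) \<and>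
     (\<forall>a k l. cnj (\<gamma> a $ l $ k) = - \<gamma> a $ k $ l)"

definition clifford_vec :: "('n::finite \<Rightarrow> complex ^ 's ^ 's::finite) \<Rightarrow> real ^ 'n \<Rightarrow> complex ^ 's ^ 's" where
  "clifford_vec \<gamma> v = (\<Sum>a\<in>UNIV. (v $ a) *\<^sub>R \<gamma> a)"

text \<open>
  \<open>Spin(n)\<close> consists of the products of an even number of unit vectors in the Clifford
  algebra.  It is realised here by its image under the spinor representation, which is
  faithful on the even part of the Clifford algebra.
\<close>

inductive_set spin_group :: "('n::finite \<Rightarrow> complex ^ 's ^ 's::finite) \<Rightarrow> (complex ^ 's ^ 's) set"
  for \<gamma> :: "'n::finite \<Rightarrow> complex ^ 's ^ 's::finite" where
  "mat 1 \<in> spin_group \<gamma>"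
| "A \<in> spin_group \<gamma> \<Longrightarrow> norm v = 1 \<Longrightarrow> norm w = 1 \<Longrightarrow>
     A ** clifford_vec \<gamma> v ** clifford_vec \<gamma> w \<in> spin_group \<gamma>"

text \<open>\<open>T\<close> lies over the rotation \<open>Q\<close> under the double covering of \<open>SO(n)\<close> by \<open>Spin(n)\<close>:
  \<open>T v T\<^sup>-\<^sup>1 = Q v\<close> in the Clifford algebra.\<close>

definition spin_covers ::
    "('n::finite \<Rightarrow> complex ^ 's ^ 's::finite) \<Rightarrow> complex ^ 's ^ 's \<Rightarrow> real ^ 'n ^ 'n \<Rightarrow> bool" where
  "spin_covers \<gamma> T Q \<longleftrightarrow> T \<in> spin_group \<gamma> \<and> rotation_matrix Q \<and>
     (\<forall>v. T ** clifford_vec \<gamma> v ** matrix_inv T = clifford_vec \<gamma> (Q *v v))"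

definition frame_transition ::
    "'m metric \<Rightarrow> ('n \<Rightarrow> 'm vfield) \<Rightarrow> ('n \<Rightarrow> 'm vfield) \<Rightarrow> 'm \<Rightarrow> real ^ 'n ^ 'n::finite" where
  "frame_transition g e e' x = (\<chi> a b. g x (e' b x) (e a x))"

definition smooth_cfun_on ::
    "('m::topological_space, 'n::finite) chart set \<Rightarrow> 'm set \<Rightarrow> ('m \<Rightarrow> complex) \<Rightarrow> bool" where
  "smooth_cfun_on \<A> U h \<longleftrightarrow>
     smooth_fun_on \<A> U (\<lambda>x. Re (h x)) \<and> smooth_fun_on \<A> U (\<lambda>x. Im (h x))"

text \<open>
  An orientation and a spin structure, as a cocycle: an open cover \<open>U\<close> by domains of
  orthonormal frames \<open>E i\<close> whose \<open>SO(n)\<close>-valued transition functions are lifted to a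
  \<open>Spin(n)\<close>-valued cocycle \<open>\<tau>\<close>.
\<close>

definition spin_structure ::
    "('m::topological_space, 'n::finite) chart set \<Rightarrow> 'm metric \<Rightarrow> ('n \<Rightarrow> complex ^ 's ^ 's::finite) \<Rightarrow>
     ('i \<Rightarrow> 'm set) \<Rightarrow> ('i \<Rightarrow> 'n \<Rightarrow> 'm vfield) \<Rightarrow> ('i \<Rightarrow> 'i \<Rightarrow> 'm \<Rightarrow> complex ^ 's ^ 's) \<Rightarrow> bool" where
  "spin_structure \<A> g \<gamma> U E \<tau> \<longleftrightarrow>
     (\<Union>i. U i) = UNIV \<and>
     (\<forall>i. orthonormal_frame \<A> g (U i) (E i)) \<and>
     (\<forall>i j k l. smooth_cfun_on \<A> (U i \<inter> U j) (\<lambda>x. \<tau> i j x $ k $ l)) \<and>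
     (\<forall>i j. \<forall>x\<in>U i \<inter> U j. spin_covers \<gamma> (\<tau> i j x) (frame_transition g (E i) (E j) x)) \<and>
     (\<forall>i j k. \<forall>x\<in>U i \<inter> U j \<inter> U k. \<tau> i j x ** \<tau> j k x = \<tau> i k x)"


section \<open>Spinor fields and the weighted Dirac operator\<close>

text \<open>
  A section \<open>\<psi>\<close> of the spinor bundle associated with the cocycle \<open>\<tau>\<close> is the family of its
  representatives \<open>\<psi> i\<close> in the local trivialisations over \<open>U i\<close>; only the values of
  \<open>\<psi> i\<close> on \<open>U i\<close> matter.
\<close>

type_synonym ('i, 'm, 's) spinor_field = "'i \<Rightarrow> 'm \<Rightarrow> complex ^ 's"

definition smooth_spinor ::
    "('m::topological_space, 'n::finite) chart set \<Rightarrow> ('i \<Rightarrow> 'm set) \<Rightarrow>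
     ('i \<Rightarrow> 'i \<Rightarrow> 'm \<Rightarrow> complex ^ 's ^ 's::finite) \<Rightarrow> ('i, 'm, 's) spinor_field \<Rightarrow> bool" where
  "smooth_spinor \<A> U \<tau> \<psi> \<longleftrightarrow>
     (\<forall>i k. smooth_cfun_on \<A> (U i) (\<lambda>x. \<psi> i x $ k)) \<and>
     (\<forall>i j. \<forall>x\<in>U i \<inter> U j. \<psi> i x = \<tau> i j x *v \<psi> j x)"

definition clifford_mult ::
    "'m metric \<Rightarrow> ('n::finite \<Rightarrow> complex ^ 's ^ 's::finite) \<Rightarrow> ('i \<Rightarrow> 'n \<Rightarrow> 'm vfield) \<Rightarrow>
     'm vfield \<Rightarrow> ('i, 'm, 's) spinor_field \<Rightarrow> ('i, 'm, 's) spinor_field" where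
  "clifford_mult g \<gamma> E X \<psi> =
     (\<lambda>i x. clifford_vec \<gamma> (\<chi> a. g x (X x) (E i a x)) *v \<psi> i x)"

definition vec_deriv :: "'m tvec \<Rightarrow> ('m \<Rightarrow> complex ^ 's) \<Rightarrow> complex ^ 's::finite" where
  "vec_deriv v F = (\<chi> k. Complex (v (\<lambda>y. Re (F y $ k))) (v (\<lambda>y. Im (F y $ k))))"

text \<open>
  The lift of the Levi-Civita connection: in the trivialisation given by \<open>E i\<close>,
  \<open>\<nabla>\<^sub>X \<psi> = X(\<psi>) + 1/4 \<Sum> g(\<nabla>\<^sub>X e\<^sub>a, e\<^sub>b) e\<^sub>a \<cdot> e\<^sub>b \<cdot> \<psi>\<close>, the sum being over all pairs \<open>a, b\<close>.
\<close>

definition spin_connection ::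
    "'m metric \<Rightarrow> 'm connection \<Rightarrow> ('n::finite \<Rightarrow> complex ^ 's ^ 's::finite) \<Rightarrow>
     ('i \<Rightarrow> 'n \<Rightarrow> 'm vfield) \<Rightarrow> 'm vfield \<Rightarrow> ('i, 'm, 's) spinor_field \<Rightarrow> ('i, 'm, 's) spinor_field" where
  "spin_connection g nabla \<gamma> E X \<psi> = (\<lambda>i x.
     vec_deriv (X x) (\<psi> i) +
     (1 / 4) *\<^sub>R (\<Sum>a\<in>UNIV. \<Sum>b\<in>UNIV.
        g x (nabla X (E i a) x) (E i b x) *\<^sub>R ((\<gamma> a ** \<gamma> b) *v \<psi> i x)))"

definition spinor_hessian ::
    "'m metric \<Rightarrow> 'm connection \<Rightarrow> ('n::finite \<Rightarrow> complex ^ 's ^ 's::finite) \<Rightarrow>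
     ('i \<Rightarrow> 'n \<Rightarrow> 'm vfield) \<Rightarrow> ('i, 'm, 's) spinor_field \<Rightarrow>
     'm vfield \<Rightarrow> 'm vfield \<Rightarrow> ('i, 'm, 's) spinor_field" where
  "spinor_hessian g nabla \<gamma> E \<psi> X Y = (\<lambda>i x.
     spin_connection g nabla \<gamma> E X (spin_connection g nabla \<gamma> E Y \<psi>) i x -
     spin_connection g nabla \<gamma> E (nabla X Y) \<psi> i x)"

definition spinor_laplacian ::
    "('m::topological_space, 'n::finite) chart set \<Rightarrow> 'm metric \<Rightarrow> 'm connection \<Rightarrow>
     ('n \<Rightarrow> complex ^ 's ^ 's::finite) \<Rightarrow> ('i \<Rightarrow> 'n \<Rightarrow> 'm vfield) \<Rightarrow>
     ('i, 'm, 's) spinor_field \<Rightarrow> ('i, 'm, 's) spinor_field" where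
  "spinor_laplacian \<A> g nabla \<gamma> E \<psi> =
     (\<lambda>i x. metric_trace \<A> g x (\<lambda>X Y. spinor_hessian g nabla \<gamma> E \<psi> X Y i x))"

definition weighted_spinor_laplacian ::
    "('m::topological_space, 'n::finite) chart set \<Rightarrow> 'm metric \<Rightarrow> 'm connection \<Rightarrow>
     ('n \<Rightarrow> complex ^ 's ^ 's::finite) \<Rightarrow> ('i \<Rightarrow> 'n \<Rightarrow> 'm vfield) \<Rightarrow> ('m \<Rightarrow> real) \<Rightarrow>
     ('i, 'm, 's) spinor_field \<Rightarrow> ('i, 'm, 's) spinor_field" where
  "weighted_spinor_laplacian \<A> g nabla \<gamma> E f \<psi> = (\<lambda>i x.
     spinor_laplacian \<A> g nabla \<gamma> E \<psi> i x -
     spin_connection g nabla \<gamma> E (gradient \<A> g f) \<psi> i x)"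

definition dirac ::
    "('m::topological_space, 'n::finite) chart set \<Rightarrow> 'm metric \<Rightarrow> 'm connection \<Rightarrow>
     ('n \<Rightarrow> complex ^ 's ^ 's::finite) \<Rightarrow> ('i \<Rightarrow> 'n \<Rightarrow> 'm vfield) \<Rightarrow>
     ('i, 'm, 's) spinor_field \<Rightarrow> ('i, 'm, 's) spinor_field" where
  "dirac \<A> g nabla \<gamma> E \<psi> = (\<lambda>i x.
     metric_trace \<A> g x (\<lambda>X Y. clifford_mult g \<gamma> E X (spin_connection g nabla \<gamma> E Y \<psi>) i x))"

definition weighted_dirac ::
    "('m::topological_space, 'n::finite) chart set \<Rightarrow> 'm metric \<Rightarrow> 'm connection \<Rightarrow>
     ('n \<Rightarrow> complex ^ 's ^ 's::finite) \<Rightarrow> ('i \<Rightarrow> 'n \<Rightarrow> 'm vfield) \<Rightarrow> ('m \<Rightarrow> real) \<Rightarrow>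
     ('i, 'm, 's) spinor_field \<Rightarrow> ('i, 'm, 's) spinor_field" where
  "weighted_dirac \<A> g nabla \<gamma> E f \<psi> = (\<lambda>i x.
     dirac \<A> g nabla \<gamma> E \<psi> i x -
     (1 / 2) *\<^sub>R clifford_mult g \<gamma> E (gradient \<A> g f) \<psi> i x)"

end

(*
The statement is local: over U i all operators are computed in the trivialisation given by the
orthonormal frame e = E i, so the cocycle plays no role. The metric traces are taken over all
orthonormal frames near a point, but every form traced here is tensorial, so each trace is the sum
over e. Write p_d, q_cd for nabla_d psi and nabla_c nabla_d psi, and nabla_c e_d = sum_b w_cdb e_b.
Then D^2 psi is a sum of terms e_c e_d q_cd and w_cdb e_c e_b p_d; the Clifford relation and the
antisymmetry of w_cdb in d, b split it into minus the spinor Laplacian and half the Clifford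
contraction of the spin curvature, which the Bianchi identity turns into R/4. In the weighted
square the terms of first order in psi combine to the derivative along grad f, since
e_c e_d + e_d e_c = -2 delta_cd, and the symmetric Hessian of f contracts to -(Laplacian f).
*)
theory Submission imports Defs begin

section \<open>Clifford algebra of curvature tensors\<close>

text \<open>The frame comes with the trivialisation, so it cannot be taken parallel at the point, as
  the usual shortcut does. Its connection coefficients stay in every formula, and it is their
  antisymmetry that assembles them into covariant Hessians.

  A metric trace is a definite description over all frames near the point, on domains of any size.
  Tensoriality is therefore stated for germs of fields, which avoids extending local fields. Ricci
  is itself a trace, so its tensoriality can only be shown after that trace has been evaluated.

  The spin curvature is the spin action of the Riemann curvature because \<open>spin_action\<close>
  respects commutators and the quadratic term of Cartan's structure equation is exactly such a
  commutator.

  The constant in R/4 is 1/4 * (-2) * (-1) * 1/2: the normalisation of the spin action, the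
  contraction of three Clifford factors by the Bianchi identity, the contraction of the symmetric
  Ricci tensor, and the half left by antisymmetrising second derivatives. In the index convention
  used here \<open>R b a a b\<close> is the sectional curvature of the plane of e_a and e_b when a
  and b differ, positive on round spheres.\<close>

locale clifford_action =
  fixes G :: "'n::finite \<Rightarrow> 'v::real_vector \<Rightarrow> 'v"
  assumes linear: "linear (G a)"
    and clifford: "G a (G b v) + G b (G a v) = (if a = b then - 2 *\<^sub>R v else 0)"
begin

lemmas G_add = linear_add[OF linear]
  and G_diff = linear_diff[OF linear]
  and G_minus = linear_neg[OF linear]
  and G_scaleR = linear_scale[OF linear]
  and G_sum = linear_sum[OF linear]

lemma swap: "G b (G a v) = - G a (G b v) - (if a = b then 2 *\<^sub>R v else 0)"
proof -
  have "G b (G a v) = (if a = b then - 2 *\<^sub>R v else 0) - G a (G b v)"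
    using clifford[of a b v] by (metis add_diff_cancel_left')
  then show ?thesis by simp
qed

text \<open>Anticommuting the two factors costs twice the diagonal. The Laplacians, the squared norm
  of the gradient and the derivative along the gradient all come out of this diagonal.\<close>

lemma sum_swap_indices:
  "(\<Sum>c\<in>UNIV. \<Sum>d\<in>UNIV. G d (G c (q c d))) =
    - (\<Sum>c\<in>UNIV. \<Sum>d\<in>UNIV. G c (G d (q c d))) - 2 *\<^sub>R (\<Sum>c\<in>UNIV. q c c)"
proof -
  have "(\<Sum>c\<in>UNIV. \<Sum>d\<in>UNIV. G d (G c (q c d))) =
      (\<Sum>c\<in>UNIV. \<Sum>d\<in>UNIV. - G c (G d (q c d)) - (if c = d then 2 *\<^sub>R q c d else 0))"
    by (intro sum.cong refl) (rule swap)
  then show ?thesis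
    by (simp add: sum_subtractf sum_negf scaleR_sum_right)
qed

lemma eq_minus_self_imp:
  fixes S v :: "'w::real_vector"
  assumes "S = - S - 2 *\<^sub>R v"
  shows "S = - v"
proof -
  have "2 *\<^sub>R (S + v) = S + (S + 2 *\<^sub>R v)"
    by (simp add: scaleR_2)
  also have "\<dots> = 0" by (subst assms) simp
  finally show ?thesis by (simp add: eq_neg_iff_add_eq_0)
qed

text \<open>Renaming the indices and then anticommuting the factors returns the sum with the
  opposite sign, up to its diagonal; hence only the diagonal survives.\<close>

lemma sum_symmetric:
  assumes "\<And>a b. H a b = (H b a :: real)"
  shows "(\<Sum>a\<in>UNIV. \<Sum>b\<in>UNIV. H a b *\<^sub>R G a (G b v)) = - (\<Sum>a\<in>UNIV. H a a) *\<^sub>R v"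
proof -
  let ?S = "\<Sum>a\<in>UNIV. \<Sum>b\<in>UNIV. H a b *\<^sub>R G a (G b v)"
  have "?S = (\<Sum>a\<in>UNIV. \<Sum>b\<in>UNIV. H a b *\<^sub>R G b (G a v))"
    by (subst sum.swap, intro sum.cong refl, subst assms, rule refl)
  also have "\<dots> = - ?S - 2 *\<^sub>R (\<Sum>a\<in>UNIV. H a a *\<^sub>R v)"
    using sum_swap_indices[of "\<lambda>a b. H a b *\<^sub>R v"] by (simp add: G_scaleR)
  finally have "?S = - (\<Sum>a\<in>UNIV. H a a *\<^sub>R v)"
    by (rule eq_minus_self_imp)
  then show ?thesis by (simp add: scaleR_sum_left)
qed

text \<open>For antisymmetric \<open>w\<close> this is the isomorphism from so(n) to spin(n) that
  inverts the differential of the double covering. The factor 1/4, with each pair counted in both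
  orders, makes the commutator with Clifford multiplication the map sending e_c to the sum of the
  \<open>w c b\<close> e_b. It is also the zeroth-order part of the spin connection.\<close>

definition spin_action :: "('n \<Rightarrow> 'n \<Rightarrow> real) \<Rightarrow> 'v \<Rightarrow> 'v" where
  "spin_action w v = (1 / 4) *\<^sub>R (\<Sum>a\<in>UNIV. \<Sum>b\<in>UNIV. w a b *\<^sub>R G a (G b v))"

lemma linear_spin_action: "linear (spin_action w)"
  unfolding spin_action_def
  by (intro linearI) (simp_all add: G_add G_scaleR scaleR_add_right sum.distrib scaleR_sum_right mult.commute)

lemmas spin_action_add = linear_add[OF linear_spin_action]
  and spin_action_diff = linear_diff[OF linear_spin_action]
  and spin_action_scaleR = linear_scale[OF linear_spin_action]
  and spin_action_sum = linear_sum[OF linear_spin_action]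

text \<open>This is the infinitesimal form of T v T^-1 = Q v. Moving \<open>G c\<close> to the left
  past \<open>G b\<close> and \<open>G a\<close> leaves two delta terms; antisymmetry makes them add
  up to four copies of the first sum, which the factor 1/4 turns into one.\<close>

lemma spin_action_clifford:
  assumes "\<And>a b. w a b = - w b a"
  shows "spin_action w (G c v) = (\<Sum>b\<in>UNIV. w c b *\<^sub>R G b v) + G c (spin_action w v)"
proof -
  have term_eq: "w a b *\<^sub>R G a (G b (G c v)) = w a b *\<^sub>R G c (G a (G b v)) +
      (if a = c then 2 *\<^sub>R w a b *\<^sub>R G b v else 0) - (if b = c then 2 *\<^sub>R w a b *\<^sub>R G a v else 0)" for a b
  proof -
    have "G a (G b (G c v)) = - G a (G c (G b v)) - (if b = c then 2 *\<^sub>R G a v else 0)"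
      by (subst swap[of b c]) (auto simp: G_minus G_diff G_scaleR linear_0[OF linear])
    also have "G a (G c (G b v)) = - G c (G a (G b v)) - (if a = c then 2 *\<^sub>R G b v else 0)"
      by (subst swap[of a c]) auto
    finally show ?thesis by (simp add: scaleR_diff_right scaleR_add_right)
  qed
  have "(\<Sum>a\<in>UNIV. \<Sum>b\<in>UNIV. w a b *\<^sub>R G a (G b (G c v))) =
      (\<Sum>a\<in>UNIV. \<Sum>b\<in>UNIV. w a b *\<^sub>R G c (G a (G b v)))
      + (\<Sum>a\<in>UNIV. \<Sum>b\<in>UNIV. if a = c then 2 *\<^sub>R w a b *\<^sub>R G b v else 0)
      - (\<Sum>a\<in>UNIV. \<Sum>b\<in>UNIV. if b = c then 2 *\<^sub>R w a b *\<^sub>R G a v else 0)"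
    by (simp add: term_eq sum.distrib sum_subtractf)
  also have "(\<Sum>a\<in>UNIV. \<Sum>b\<in>UNIV. if a = c then 2 *\<^sub>R w a b *\<^sub>R G b v else 0) =
      2 *\<^sub>R (\<Sum>b\<in>UNIV. w c b *\<^sub>R G b v)"
    by (subst sum.swap) (simp add: scaleR_sum_right)
  also have "(\<Sum>a\<in>UNIV. \<Sum>b\<in>UNIV. if b = c then 2 *\<^sub>R w a b *\<^sub>R G a v else 0) =
      - 2 *\<^sub>R (\<Sum>b\<in>UNIV. w c b *\<^sub>R G b v)"
    by (subst assms) (simp add: scaleR_sum_right sum_negf)
  finally show ?thesis
    unfolding spin_action_def
    by (simp add: G_scaleR G_sum scaleR_add_right scaleR_diff_right flip: scaleR_add_left)
qed

text \<open>The spin action represents the Lie algebra of antisymmetric matrices.\<close>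

lemma spin_action_commutator:
  assumes w: "\<And>a b. w a b = - w b a" and z: "\<And>a b. z a b = - z b a"
  shows "spin_action w (spin_action z v) - spin_action z (spin_action w v) =
    spin_action (\<lambda>a b. \<Sum>c\<in>UNIV. w a c * z b c - z a c * w b c) v"
proof -
  \<comment> \<open>The outer action is pushed through both Clifford factors of the inner one.
    Having passed them, it forms the product in the other order; what it leaves behind are the two
    halves of the matrix commutator.\<close>
  have "spin_action w (spin_action z v) =
      (1/4) *\<^sub>R (\<Sum>a\<in>UNIV. \<Sum>b\<in>UNIV. z a b *\<^sub>R spin_action w (G a (G b v)))"
    by (subst (2) spin_action_def) (simp add: spin_action_scaleR spin_action_sum)
  also have "\<dots> = (1/4) *\<^sub>R ((\<Sum>a\<in>UNIV. \<Sum>b\<in>UNIV. \<Sum>c\<in>UNIV. (z a b * w a c) *\<^sub>R G c (G b v))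
      + (\<Sum>a\<in>UNIV. \<Sum>b\<in>UNIV. \<Sum>c\<in>UNIV. (z a b * w b c) *\<^sub>R G a (G c v)))
      + spin_action z (spin_action w v)"
    by (simp add: spin_action_clifford[OF w] G_add G_sum G_scaleR scaleR_add_right sum.distrib
        scaleR_sum_right add.assoc) (simp add: spin_action_def scaleR_sum_right)
  also have "(\<Sum>a\<in>UNIV. \<Sum>b\<in>UNIV. \<Sum>c\<in>UNIV. (z a b * w a c) *\<^sub>R G c (G b v)) =
      (\<Sum>a\<in>UNIV. \<Sum>b\<in>UNIV. \<Sum>c\<in>UNIV. (w a c * z b c) *\<^sub>R G a (G b v))"
  proof -
    have "(\<Sum>a\<in>UNIV. \<Sum>b\<in>UNIV. \<Sum>c\<in>UNIV. (z a b * w a c) *\<^sub>R G c (G b v)) =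
      (\<Sum>b\<in>UNIV. \<Sum>c\<in>UNIV. \<Sum>a\<in>UNIV. (z a b * w a c) *\<^sub>R G c (G b v))"
      by (subst sum.swap, rule sum.cong[OF refl], rule sum.swap)
    also have "\<dots> = (\<Sum>c\<in>UNIV. \<Sum>b\<in>UNIV. \<Sum>a\<in>UNIV. (z a b * w a c) *\<^sub>R G c (G b v))"
      by (rule sum.swap)
    also have "\<dots> = (\<Sum>c\<in>UNIV. \<Sum>b\<in>UNIV. \<Sum>a\<in>UNIV. (w c a * z b a) *\<^sub>R G c (G b v))"
      by (intro sum.cong refl) (metis (no_types, opaque_lifting) w z minus_mult_minus mult.commute)
    finally show ?thesis .
  qed
  also have "(\<Sum>a\<in>UNIV. \<Sum>b\<in>UNIV. \<Sum>c\<in>UNIV. (z a b * w b c) *\<^sub>R G a (G c v)) =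
      - (\<Sum>a\<in>UNIV. \<Sum>b\<in>UNIV. \<Sum>c\<in>UNIV. (z a c * w b c) *\<^sub>R G a (G b v))"
  proof -
    have "(\<Sum>b\<in>UNIV. \<Sum>c\<in>UNIV. (z a b * w b c) *\<^sub>R G a (G c v)) =
      (\<Sum>c\<in>UNIV. \<Sum>b\<in>UNIV. - ((z a b * w c b) *\<^sub>R G a (G c v)))" for a
      by (subst sum.swap) (intro sum.cong refl, subst w, simp)
    then show ?thesis by (simp add: sum_negf)
  qed
  finally show ?thesis
    by (simp add: spin_action_def scaleR_diff_left sum_subtractf scaleR_sum_left)
qed

end

text \<open>Index convention: \<open>R c d a b = g(R(e\<^sub>c, e\<^sub>d) e\<^sub>a, e\<^sub>b)\<close>.\<close>

locale algebraic_curvature =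
  fixes R :: "'n::finite \<Rightarrow> 'n \<Rightarrow> 'n \<Rightarrow> 'n \<Rightarrow> real"
  assumes anti1: "R c d a b = - R d c a b"
    and anti2: "R c d a b = - R c d b a"
    and bianchi: "R c d a b + R d a c b + R a c d b = 0"
begin

text \<open>Four Bianchi identities are added, one for each choice of the last index. Antisymmetry
  in the last pair cancels eight of the twelve terms, and the other four are twice
  \<open>R c d a b\<close> minus twice \<open>R a b c d\<close>.\<close>

lemma pair_symmetry: "R c d a b = R a b c d"
proof -
  have "R c b d a = - R c b a d" "R b d c a = - R b d a c" "R d a b c = - R d a c b"
    "R a c d b = - R a c b d" "R a b d c = - R a b c d"
    by (rule anti2)+
  moreover have "R d c b a = R c d a b" "R b a c d = - R a b c d"
    using anti1[of d c b a] anti2[of c d b a] anti1[of b a c d] by simp_all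
  ultimately show ?thesis
    using bianchi[of c b d a] bianchi[of b d a c] bianchi[of d a c b] bianchi[of a c b d]
    by linarith
qed

end

locale clifford_curvature = clifford_action G + algebraic_curvature R
  for G :: "'n::finite \<Rightarrow> 'v::real_vector \<Rightarrow> 'v"
    and R :: "'n \<Rightarrow> 'n \<Rightarrow> 'n \<Rightarrow> 'n \<Rightarrow> real"
begin

text \<open>Rotating the indices of \<open>R\<close> cyclically amounts to rotating the three
  Clifford factors, and each rotation restores the original product up to delta terms. The Bianchi
  identity thus becomes 3 S + 6 P = 0: the totally antisymmetric part of the product drops out and a
  Ricci contraction remains.\<close>

lemma curvature_contraction_3:
  "(\<Sum>c\<in>UNIV. \<Sum>d\<in>UNIV. \<Sum>a\<in>UNIV. R c d a b *\<^sub>R G c (G d (G a v))) =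
    - 2 *\<^sub>R (\<Sum>c\<in>UNIV. \<Sum>a\<in>UNIV. R c a a b *\<^sub>R G c v)" (is "?S = - 2 *\<^sub>R ?P")
proof -
  have 1: "(\<Sum>c\<in>UNIV. \<Sum>d\<in>UNIV. \<Sum>a\<in>UNIV. R d a c b *\<^sub>R G c (G d (G a v))) =
      (\<Sum>c\<in>UNIV. \<Sum>d\<in>UNIV. \<Sum>a\<in>UNIV. R c d a b *\<^sub>R G a (G c (G d v)))"
    by (subst sum.swap, rule sum.cong[OF refl], rule sum.swap)
  have 2: "(\<Sum>c\<in>UNIV. \<Sum>d\<in>UNIV. \<Sum>a\<in>UNIV. R a c d b *\<^sub>R G c (G d (G a v))) =
      (\<Sum>c\<in>UNIV. \<Sum>d\<in>UNIV. \<Sum>a\<in>UNIV. R c d a b *\<^sub>R G d (G a (G c v)))"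
    by (subst sum.swap[where A=UNIV and B=UNIV and g="\<lambda>c d. \<Sum>a\<in>UNIV. R c d a b *\<^sub>R G d (G a (G c v))"],
        rule sum.cong[OF refl], rule sum.swap)
  have "(\<Sum>c\<in>UNIV. \<Sum>d\<in>UNIV. \<Sum>a\<in>UNIV.
      (R c d a b + R d a c b + R a c d b) *\<^sub>R G c (G d (G a v))) = 0"
    by (simp add: bianchi)
  then have 3: "?S + (\<Sum>c\<in>UNIV. \<Sum>d\<in>UNIV. \<Sum>a\<in>UNIV. R c d a b *\<^sub>R G a (G c (G d v)))
      + (\<Sum>c\<in>UNIV. \<Sum>d\<in>UNIV. \<Sum>a\<in>UNIV. R c d a b *\<^sub>R G d (G a (G c v))) = 0"
    by (simp add: scaleR_add_left sum.distrib 1 2)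
  \<comment> \<open>A rotation of three factors is two transpositions, so the leading sign is
    plus.\<close>
  have t1: "G a (G c (G d v)) = G c (G d (G a v)) + (if a = d then 2 *\<^sub>R G c v else 0)
      - (if a = c then 2 *\<^sub>R G d v else 0)" for a c d
  proof -
    have "G a (G c (G d v)) = - G c (G a (G d v)) - (if a = c then 2 *\<^sub>R G d v else 0)"
      using swap[of a c "G d v"] by auto
    moreover have "G a (G d v) = - G d (G a v) - (if a = d then 2 *\<^sub>R v else 0)"
      using swap[of a d v] by auto
    ultimately show ?thesis by (simp add: G_diff G_minus G_scaleR linear_0[OF linear])
  qed
  have t2: "G d (G a (G c v)) = G c (G d (G a v)) + (if c = d then 2 *\<^sub>R G a v else 0)
      - (if a = c then 2 *\<^sub>R G d v else 0)" for a c d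
  proof -
    have "G a (G c v) = - G c (G a v) - (if a = c then 2 *\<^sub>R v else 0)"
      using swap[of a c v] by auto
    moreover have "G d (G c (G a v)) = - G c (G d (G a v)) - (if c = d then 2 *\<^sub>R G a v else 0)"
      using swap[of d c "G a v"] by auto
    ultimately show ?thesis by (simp add: G_diff G_minus G_scaleR linear_0[OF linear])
  qed
  have z: "R c c a b = 0" for c a using anti1[of c c a b] by simp
  have 4: "(\<Sum>c\<in>UNIV. \<Sum>d\<in>UNIV. \<Sum>a\<in>UNIV. R c d a b *\<^sub>R (if a = c then 2 *\<^sub>R G d v else 0)) =
      - 2 *\<^sub>R ?P"
  proof -
    have "(\<Sum>c\<in>UNIV. \<Sum>d\<in>UNIV. \<Sum>a\<in>UNIV. R c d a b *\<^sub>R (if a = c then 2 *\<^sub>R G d v else 0)) =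
       (\<Sum>c\<in>UNIV. \<Sum>d\<in>UNIV. 2 *\<^sub>R R c d c b *\<^sub>R G d v)"
      by (simp add: if_distrib[of "scaleR _"] mult.commute cong: if_cong)
    also have "\<dots> = - (\<Sum>d\<in>UNIV. \<Sum>c\<in>UNIV. 2 *\<^sub>R R d c c b *\<^sub>R G d v)"
      by (subst sum.swap, subst anti1) (simp add: sum_negf)
    finally show ?thesis by (simp add: scaleR_sum_right sum_negf mult.commute)
  qed
  have 5: "(\<Sum>c\<in>UNIV. \<Sum>d\<in>UNIV. \<Sum>a\<in>UNIV. R c d a b *\<^sub>R (if a = d then 2 *\<^sub>R G c v else 0)) = 2 *\<^sub>R ?P"
    by (simp add: if_distrib[of "scaleR _"] scaleR_sum_right mult.commute cong: if_cong)
  \<comment> \<open>Here the delta meets the antisymmetric pair of \<open>R\<close>. Hence the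
    rotation in \<open>8\<close> yields one copy of twice \<open>?P\<close>, and that in
    \<open>7\<close> yields two.\<close>
  have 6: "(\<Sum>c\<in>UNIV. \<Sum>d\<in>UNIV. \<Sum>a\<in>UNIV. R c d a b *\<^sub>R (if c = d then 2 *\<^sub>R G a v else 0)) = 0"
    by (intro sum.neutral ballI) (simp add: z)
  have multiples: "3 *\<^sub>R S = S + S + S" "6 *\<^sub>R P = 2 *\<^sub>R P + 2 *\<^sub>R P + 2 *\<^sub>R P" for S P :: 'v
    using scaleR_add_left[of 2 1 S] scaleR_add_left[of 4 2 P] scaleR_add_left[of 2 2 P]
    by (simp_all add: scaleR_2)
  have 7: "(\<Sum>c\<in>UNIV. \<Sum>d\<in>UNIV. \<Sum>a\<in>UNIV. R c d a b *\<^sub>R G a (G c (G d v))) =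
      ?S + 2 *\<^sub>R ?P + 2 *\<^sub>R ?P" (is "?A = _")
  proof -
    have "?A = (\<Sum>c\<in>UNIV. \<Sum>d\<in>UNIV. \<Sum>a\<in>UNIV. R c d a b *\<^sub>R G c (G d (G a v))
        + R c d a b *\<^sub>R (if a = d then 2 *\<^sub>R G c v else 0)
        - R c d a b *\<^sub>R (if a = c then 2 *\<^sub>R G d v else 0))"
      by (intro sum.cong refl, subst t1) (simp only: scaleR_add_right scaleR_diff_right)
    then show ?thesis
      by (simp only: sum.distrib sum_subtractf 4 5) simp
  qed
  have 8: "(\<Sum>c\<in>UNIV. \<Sum>d\<in>UNIV. \<Sum>a\<in>UNIV. R c d a b *\<^sub>R G d (G a (G c v))) =
      ?S + 2 *\<^sub>R ?P" (is "?A = _")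
  proof -
    have "?A = (\<Sum>c\<in>UNIV. \<Sum>d\<in>UNIV. \<Sum>a\<in>UNIV. R c d a b *\<^sub>R G c (G d (G a v))
        + R c d a b *\<^sub>R (if c = d then 2 *\<^sub>R G a v else 0)
        - R c d a b *\<^sub>R (if a = c then 2 *\<^sub>R G d v else 0))"
      by (intro sum.cong refl, subst t2) (simp only: scaleR_add_right scaleR_diff_right)
    then show ?thesis
      by (simp only: sum.distrib sum_subtractf 4 6) simp
  qed
  have "3 *\<^sub>R ?S + 6 *\<^sub>R ?P = 0"
    using 3 unfolding 7 8 multiples by (simp only: ac_simps)
  then have "3 *\<^sub>R (?S + 2 *\<^sub>R ?P) = 0" by (simp only: scaleR_add_right scaleR_scaleR) simp
  then have "?S + 2 *\<^sub>R ?P = 0" by (simp only: scaleR_eq_0_iff) simp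
  then show ?thesis by (simp only: add_eq_0_iff2 scaleR_minus_left)
qed

text \<open>Contracting three factors leaves -2 times the Ricci tensor against two factors. Being
  symmetric, it contracts to minus its trace; with the 1/4 of \<open>spin_action\<close> this gives
  1/2.\<close>

lemma curvature_contraction:
  "(\<Sum>c\<in>UNIV. \<Sum>d\<in>UNIV. G c (G d (spin_action (R c d) v))) =
    ((1 / 2) * (\<Sum>a\<in>UNIV. \<Sum>b\<in>UNIV. R b a a b)) *\<^sub>R v"
proof -
  have "(\<Sum>c\<in>UNIV. \<Sum>d\<in>UNIV. G c (G d (spin_action (R c d) v))) =
      (1 / 4) *\<^sub>R (\<Sum>c\<in>UNIV. \<Sum>d\<in>UNIV. \<Sum>a\<in>UNIV. \<Sum>b\<in>UNIV. R c d a b *\<^sub>R G c (G d (G a (G b v))))"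
    by (simp add: spin_action_def G_scaleR G_sum scaleR_sum_right)
  also have "(\<Sum>c\<in>UNIV. \<Sum>d\<in>UNIV. \<Sum>a\<in>UNIV. \<Sum>b\<in>UNIV. R c d a b *\<^sub>R G c (G d (G a (G b v)))) =
      (\<Sum>b\<in>UNIV. \<Sum>c\<in>UNIV. \<Sum>d\<in>UNIV. \<Sum>a\<in>UNIV. R c d a b *\<^sub>R G c (G d (G a (G b v))))"
    (is "?L = ?R")
  proof -
    have "?L = (\<Sum>c\<in>UNIV. \<Sum>d\<in>UNIV. \<Sum>b\<in>UNIV. \<Sum>a\<in>UNIV. R c d a b *\<^sub>R G c (G d (G a (G b v))))"
      by (intro sum.cong refl sum.swap)
    also have "\<dots> = (\<Sum>c\<in>UNIV. \<Sum>b\<in>UNIV. \<Sum>d\<in>UNIV. \<Sum>a\<in>UNIV. R c d a b *\<^sub>R G c (G d (G a (G b v))))"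
      by (intro sum.cong refl sum.swap)
    also have "\<dots> = ?R"
      by (rule sum.swap)
    finally show ?thesis .
  qed
  also have "\<dots> = (\<Sum>b\<in>UNIV. - 2 *\<^sub>R (\<Sum>c\<in>UNIV. \<Sum>a\<in>UNIV. R c a a b *\<^sub>R G c (G b v)))"
    by (simp only: curvature_contraction_3)
  also have "\<dots> = - 2 *\<^sub>R (\<Sum>c\<in>UNIV. \<Sum>b\<in>UNIV. (\<Sum>a\<in>UNIV. R c a a b) *\<^sub>R G c (G b v))"
    by (subst (2) sum.swap) (simp add: scaleR_sum_right scaleR_sum_left sum_negf)
  also have "(\<Sum>c\<in>UNIV. \<Sum>b\<in>UNIV. (\<Sum>a\<in>UNIV. R c a a b) *\<^sub>R G c (G b v)) =
      - (\<Sum>b\<in>UNIV. \<Sum>a\<in>UNIV. R b a a b) *\<^sub>R v"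
  \<comment> \<open>Symmetry of the Ricci tensor, the one place where pair symmetry is used.\<close>
  proof (rule sum_symmetric)
    have "R c a a b = R b a a c" for a b c
      using pair_symmetry[of c a a b] anti1[of a b c a] anti2[of b a c a] by simp
    then show "(\<Sum>a\<in>UNIV. R c a a b) = (\<Sum>a\<in>UNIV. R b a a c)" for b c
      by simp
  qed
  also have "(\<Sum>b\<in>UNIV. \<Sum>a\<in>UNIV. R b a a b) = (\<Sum>a\<in>UNIV. \<Sum>b\<in>UNIV. R b a a b)"
    by (rule sum.swap)
  finally show ?thesis by simp
qed

text \<open>
  The Weitzenboeck argument at a point: \<open>p d\<close> and \<open>q c d\<close> stand for \<open>\<nabla>\<^sub>d \<psi>\<close> and
  \<open>\<nabla>\<^sub>c \<nabla>\<^sub>d \<psi>\<close>, and \<open>w c d b = g(\<nabla>\<^sub>c e\<^sub>d, e\<^sub>b)\<close> are the connection coefficients.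
\<close>

lemma weitzenboeck:
  assumes anti: "\<And>c d b. w c d b = - w c b d"
    and comm: "\<And>c d. q c d - q d c - (\<Sum>b\<in>UNIV. (w c d b - w d c b) *\<^sub>R p b) = spin_action (R c d) v"
  shows "(\<Sum>c\<in>UNIV. G c (\<Sum>d\<in>UNIV. (\<Sum>b\<in>UNIV. w c d b *\<^sub>R G b (p d)) + G d (q c d))) =
    - (\<Sum>c\<in>UNIV. q c c - (\<Sum>b\<in>UNIV. w c c b *\<^sub>R p b))
    + ((1 / 4) * (\<Sum>a\<in>UNIV. \<Sum>b\<in>UNIV. R b a a b)) *\<^sub>R v"
proof -
  let ?W = "\<Sum>c\<in>UNIV. \<Sum>d\<in>UNIV. \<Sum>b\<in>UNIV. w c d b *\<^sub>R G c (G d (p b))"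
  let ?Q = "\<Sum>c\<in>UNIV. \<Sum>d\<in>UNIV. G c (G d (q c d))"
  let ?T = "\<Sum>c\<in>UNIV. \<Sum>b\<in>UNIV. w c c b *\<^sub>R p b"
  let ?s = "((1 / 2) * (\<Sum>a\<in>UNIV. \<Sum>b\<in>UNIV. R b a a b)) *\<^sub>R v"
  \<comment> \<open>Antisymmetry moves the coefficient from the Clifford factor to the derivative of
    the spinor. Then \<open>?Q - ?W\<close> is the Clifford contraction of the covariant Hessian
    q_cd minus the sum of the w_cdb p_b.\<close>
  have W1: "(\<Sum>c\<in>UNIV. \<Sum>d\<in>UNIV. \<Sum>b\<in>UNIV. w c d b *\<^sub>R G c (G b (p d))) = - ?W"
  proof -
    have "(\<Sum>d\<in>UNIV. \<Sum>b\<in>UNIV. w c d b *\<^sub>R G c (G b (p d))) =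
        (\<Sum>b\<in>UNIV. \<Sum>d\<in>UNIV. - (w c b d *\<^sub>R G c (G b (p d))))" for c
      by (subst sum.swap) (intro sum.cong refl, subst anti, simp)
    then show ?thesis by (simp add: sum_negf)
  qed
  have W2: "(\<Sum>c\<in>UNIV. \<Sum>d\<in>UNIV. \<Sum>b\<in>UNIV. w d c b *\<^sub>R G c (G d (p b))) = - ?W - 2 *\<^sub>R ?T"
  proof -
    have "(\<Sum>c\<in>UNIV. \<Sum>d\<in>UNIV. \<Sum>b\<in>UNIV. w d c b *\<^sub>R G c (G d (p b))) =
        (\<Sum>c\<in>UNIV. \<Sum>d\<in>UNIV. G d (G c (\<Sum>b\<in>UNIV. w c d b *\<^sub>R p b)))"
      by (subst sum.swap) (simp add: G_sum G_scaleR)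
    also note sum_swap_indices
    finally show ?thesis by (simp add: G_sum G_scaleR)
  qed
  have Q2: "(\<Sum>c\<in>UNIV. \<Sum>d\<in>UNIV. G c (G d (q d c))) = - ?Q - 2 *\<^sub>R (\<Sum>c\<in>UNIV. q c c)"
    by (subst sum.swap) (rule sum_swap_indices)
  have "?s = (\<Sum>c\<in>UNIV. \<Sum>d\<in>UNIV. G c (G d (spin_action (R c d) v)))"
    by (rule curvature_contraction[symmetric])
  also have "\<dots> = ?Q - (\<Sum>c\<in>UNIV. \<Sum>d\<in>UNIV. G c (G d (q d c)))
      - (?W - (\<Sum>c\<in>UNIV. \<Sum>d\<in>UNIV. \<Sum>b\<in>UNIV. w d c b *\<^sub>R G c (G d (p b))))"
    unfolding comm[symmetric]
    by (simp add: G_diff G_sum G_scaleR scaleR_diff_left sum_subtractf)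
  \<comment> \<open>Twice the contraction is its symmetric part, which is the trace, plus its
    antisymmetric part, which is the curvature term.\<close>
  finally have "2 *\<^sub>R (?Q - ?W) = 2 *\<^sub>R (?T - (\<Sum>c\<in>UNIV. q c c)) + ?s"
    unfolding W2 Q2 by (simp add: scaleR_2 algebra_simps)
  then have "(1/2) *\<^sub>R 2 *\<^sub>R (?Q - ?W) = (1/2) *\<^sub>R (2 *\<^sub>R (?T - (\<Sum>c\<in>UNIV. q c c)) + ?s)"
    by (rule arg_cong)
  then have "?Q - ?W = ?T - (\<Sum>c\<in>UNIV. q c c) + (1/2) *\<^sub>R ?s"
    by (simp add: scaleR_add_right)
  moreover have "(\<Sum>c\<in>UNIV. G c (\<Sum>d\<in>UNIV. (\<Sum>b\<in>UNIV. w c d b *\<^sub>R G b (p d)) + G d (q c d))) = ?Q - ?W"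
    using W1 by (simp add: G_sum G_add G_scaleR sum.distrib)
  ultimately show ?thesis by (simp add: sum_subtractf)
qed

text \<open>
  The same for the weighted operator: \<open>u d\<close> stands for the derivative of the weight along
  \<open>e\<^sub>d\<close> and \<open>H\<close> for its Hessian.
\<close>

lemma weighted_weitzenboeck:
  assumes anti: "\<And>c d b. w c d b = - w c b d"
    and comm: "\<And>c d. q c d - q d c - (\<Sum>b\<in>UNIV. (w c d b - w d c b) *\<^sub>R p b) = spin_action (R c d) v"
    and H: "\<And>c d. H c d = H d c"
  shows "(\<Sum>c\<in>UNIV. G c ((\<Sum>d\<in>UNIV. (\<Sum>b\<in>UNIV. w c d b *\<^sub>R G b (p d)) + G d (q c d))
        - (1 / 2) *\<^sub>R (\<Sum>d\<in>UNIV. H c d *\<^sub>R G d v + u d *\<^sub>R G d (p c))))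
      - (1 / 2) *\<^sub>R (\<Sum>d\<in>UNIV. u d *\<^sub>R G d ((\<Sum>c\<in>UNIV. G c (p c)) - (1 / 2) *\<^sub>R (\<Sum>c\<in>UNIV. u c *\<^sub>R G c v))) =
    - ((\<Sum>c\<in>UNIV. q c c - (\<Sum>b\<in>UNIV. w c c b *\<^sub>R p b)) - (\<Sum>c\<in>UNIV. u c *\<^sub>R p c))
    + (1 / 4 * ((\<Sum>a\<in>UNIV. \<Sum>b\<in>UNIV. R b a a b) + 2 * (\<Sum>c\<in>UNIV. H c c) - (\<Sum>c\<in>UNIV. (u c)\<^sup>2))) *\<^sub>R v"
proof -
  let ?A = "\<Sum>c\<in>UNIV. \<Sum>d\<in>UNIV. u d *\<^sub>R G c (G d (p c))"
  have hess: "(\<Sum>c\<in>UNIV. \<Sum>d\<in>UNIV. H c d *\<^sub>R G c (G d v)) = - (\<Sum>c\<in>UNIV. H c c) *\<^sub>R v"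
    by (rule sum_symmetric[OF H])
  \<comment> \<open>Clifford multiplication by the gradient meets the Dirac operator in both orders.
    Reversing one of them cancels \<open>?A\<close> and leaves exactly the derivative along the
    gradient.\<close>
  have cross: "(\<Sum>d\<in>UNIV. \<Sum>c\<in>UNIV. u d *\<^sub>R G d (G c (p c))) = - ?A - 2 *\<^sub>R (\<Sum>c\<in>UNIV. u c *\<^sub>R p c)"
    by (subst sum.swap) (use sum_swap_indices[of "\<lambda>c d. u d *\<^sub>R p c"] in \<open>simp add: G_scaleR\<close>)
  have quad: "(\<Sum>d\<in>UNIV. \<Sum>c\<in>UNIV. (u d * u c) *\<^sub>R G d (G c v)) = - (\<Sum>c\<in>UNIV. (u c)\<^sup>2) *\<^sub>R v"
    using sum_symmetric[of "\<lambda>d c. u d * u c"] by (simp add: power2_eq_square mult.commute)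
  let ?W = "\<Sum>c\<in>UNIV. G c (\<Sum>d\<in>UNIV. (\<Sum>b\<in>UNIV. w c d b *\<^sub>R G b (p d)) + G d (q c d))"
  let ?L = "\<Sum>c\<in>UNIV. q c c - (\<Sum>b\<in>UNIV. w c c b *\<^sub>R p b)"
  have "(\<Sum>c\<in>UNIV. G c ((\<Sum>d\<in>UNIV. (\<Sum>b\<in>UNIV. w c d b *\<^sub>R G b (p d)) + G d (q c d))
        - (1 / 2) *\<^sub>R (\<Sum>d\<in>UNIV. H c d *\<^sub>R G d v + u d *\<^sub>R G d (p c)))) =
      ?W - (1 / 2) *\<^sub>R (- (\<Sum>c\<in>UNIV. H c c) *\<^sub>R v + ?A)"
    unfolding hess[symmetric]
    by (simp only: G_diff G_scaleR[of _ "1 / 2"] sum_subtractf flip: scaleR_sum_right)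
      (simp add: G_sum G_add G_scaleR sum.distrib)
  moreover have "(\<Sum>d\<in>UNIV. u d *\<^sub>R G d ((\<Sum>c\<in>UNIV. G c (p c)) - (1 / 2) *\<^sub>R (\<Sum>c\<in>UNIV. u c *\<^sub>R G c v))) =
      - ?A - 2 *\<^sub>R (\<Sum>c\<in>UNIV. u c *\<^sub>R p c) - (1 / 2) *\<^sub>R (- (\<Sum>c\<in>UNIV. (u c)\<^sup>2) *\<^sub>R v)"
    unfolding cross[symmetric] quad[symmetric]
    by (simp add: G_sum G_diff G_scaleR scaleR_diff_right sum_subtractf scaleR_sum_right)
  moreover have "?W = - ?L + ((1 / 4) * (\<Sum>a\<in>UNIV. \<Sum>b\<in>UNIV. R b a a b)) *\<^sub>R v"
    by (rule weitzenboeck[OF anti comm])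
  ultimately show ?thesis
    by (simp add: scaleR_add_right scaleR_diff_right scaleR_add_left scaleR_diff_left distrib_left right_diff_distrib)
qed

end

section \<open>Smooth functions\<close>

lemma Ck_on_subset: "Ck_on k h S \<Longrightarrow> T \<subseteq> S \<Longrightarrow> Ck_on k h T"
  by (induction k arbitrary: h) (auto intro: continuous_on_subset)

text \<open>Openness makes the two functions agree near each point, so their derivatives agree on
  \<open>S\<close> and the induction passes to them.\<close>

lemma Ck_on_cong:
  assumes "open S" "\<And>x. x \<in> S \<Longrightarrow> h x = h' x" "Ck_on k h S"
  shows "Ck_on k h' S"
  using assms(2,3)
proof (induction k arbitrary: h h')
  case 0
  then show ?case using continuous_on_cong by force
next
  case (Suc k)
  have der: "(h has_derivative F) (at x) \<longleftrightarrow> (h' has_derivative F) (at x)" if "x \<in> S" for x F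
    using has_derivative_transform_within_open[OF _ assms(1) that, of h F UNIV h']
      has_derivative_transform_within_open[OF _ assms(1) that, of h' F UNIV h] Suc.prems(1)
    by auto
  have diff: "h' differentiable (at x)" if "x \<in> S" for x
    using Suc.prems(2) that unfolding Ck_on.simps differentiable_def der[OF that, symmetric] by blast
  have "frechet_derivative h (at x) v = frechet_derivative h' (at x) v" if "x \<in> S" for x v
    using der[OF that] unfolding frechet_derivative_def by presburger
  then have "Ck_on k (\<lambda>x. frechet_derivative h' (at x) v) S" if "v \<in> Basis" for v
    using Suc.IH Suc.prems(2) that by (metis (no_types, lifting) Ck_on.simps(2))
  with diff show ?case by simp
qed

lemma Ck_on_const: "Ck_on k (\<lambda>x. c) S"
  by (induction k arbitrary: c) simp_all

lemma Ck_on_add: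
  assumes "open S" "Ck_on k h S" "Ck_on k h' S"
  shows "Ck_on k (\<lambda>x. h x + h' x) S"
  using assms(2,3)
proof (induction k arbitrary: h h')
  case 0
  then show ?case by (simp add: continuous_on_add)
next
  case (Suc k)
  have diff: "h differentiable (at x)" "h' differentiable (at x)" if "x \<in> S" for x
    using Suc.prems that by auto
  have "Ck_on k (\<lambda>x. frechet_derivative (\<lambda>x. h x + h' x) (at x) v) S" if v: "v \<in> Basis" for v
  proof (rule Ck_on_cong[OF assms(1)])
    show "Ck_on k (\<lambda>x. frechet_derivative h (at x) v + frechet_derivative h' (at x) v) S"
      using Suc v by simp
    show "frechet_derivative h (at x) v + frechet_derivative h' (at x) v =
        frechet_derivative (\<lambda>x. h x + h' x) (at x) v" if "x \<in> S" for x
      using frechet_derivative_at[OF has_derivative_add[OF diff[OF that, unfolded frechet_derivative_works]]]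
      by (simp add: fun_eq_iff)
  qed
  with Suc.prems show ?case by (auto intro: differentiable_add)
qed

lemma Cinf_on_imp_continuous_on: "Cinf_on h S \<Longrightarrow> continuous_on S h"
  unfolding Cinf_on_def using Ck_on.simps(1) by blast

lemma Cinf_on_imp_differentiable: "Cinf_on h S \<Longrightarrow> x \<in> S \<Longrightarrow> h differentiable (at x)"
  unfolding Cinf_on_def using Ck_on.simps(2) by blast

lemma Cinf_on_frechet_derivative:
  "Cinf_on h S \<Longrightarrow> v \<in> Basis \<Longrightarrow> Cinf_on (\<lambda>x. frechet_derivative h (at x) v) S"
  unfolding Cinf_on_def using Ck_on.simps(2) by blast

text \<open>At each order the product rule needs the factors themselves as well as their
  derivatives. Starting from factors smooth to all orders provides both, without comparing
  \<open>Ck_on\<close> for different orders.\<close>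

lemma Cinf_on_mult:
  fixes h h' :: "'a::euclidean_space \<Rightarrow> real"
  assumes "open S" "Cinf_on h S" "Cinf_on h' S"
  shows "Cinf_on (\<lambda>x. h x * h' x) S"
proof -
  have "Ck_on k (\<lambda>x. h x * h' x) S" for k
    using assms(2,3)
  proof (induction k arbitrary: h h')
    case 0
    then show ?case by (simp add: continuous_on_mult Cinf_on_imp_continuous_on)
  next
    case (Suc k)
    note diff = Suc.prems[THEN Cinf_on_imp_differentiable]
    have "Ck_on k (\<lambda>x. frechet_derivative (\<lambda>x. h x * h' x) (at x) v) S" if v: "v \<in> Basis" for v
    proof (rule Ck_on_cong[OF assms(1)])
      show "Ck_on k (\<lambda>x. h x * frechet_derivative h' (at x) v + frechet_derivative h (at x) v * h' x) S"
        by (intro Ck_on_add Suc.IH Cinf_on_frechet_derivative Suc.prems assms(1) v)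
      show "h x * frechet_derivative h' (at x) v + frechet_derivative h (at x) v * h' x =
          frechet_derivative (\<lambda>x. h x * h' x) (at x) v" if "x \<in> S" for x
        using frechet_derivative_at[OF has_derivative_mult[OF diff[OF that, unfolded frechet_derivative_works]]]
        by (simp add: fun_eq_iff)
    qed
    with diff show ?case by (auto intro: differentiable_mult)
  qed
  then show ?thesis by (simp add: Cinf_on_def)
qed

lemma smooth_fun_onI:
  "(\<And>V \<phi>. (V, \<phi>) \<in> \<A> \<Longrightarrow> Cinf_on (\<lambda>p. h (inv_into V \<phi> p)) (\<phi> ` (U \<inter> V))) \<Longrightarrow> smooth_fun_on \<A> U h"
  by (auto simp: smooth_fun_on_def comp_def)

lemma smooth_fun_onD:
  "smooth_fun_on \<A> U h \<Longrightarrow> (V, \<phi>) \<in> \<A> \<Longrightarrow> Cinf_on (\<lambda>p. h (inv_into V \<phi> p)) (\<phi> ` (U \<inter> V))"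
  by (auto simp: smooth_fun_on_def comp_def)

lemma smooth_fun_on_subset:
  assumes "smooth_fun_on \<A> U h" "W \<subseteq> U"
  shows "smooth_fun_on \<A> W h"
proof (rule smooth_fun_onI)
  fix V \<phi> assume V: "(V, \<phi>) \<in> \<A>"
  have "\<phi> ` (W \<inter> V) \<subseteq> \<phi> ` (U \<inter> V)" using assms(2) by blast
  then show "Cinf_on (\<lambda>p. h (inv_into V \<phi> p)) (\<phi> ` (W \<inter> V))"
    using smooth_fun_onD[OF assms(1) V] Ck_on_subset unfolding Cinf_on_def by blast
qed

lemma smooth_fun_on_const: "smooth_fun_on \<A> U (\<lambda>x. c)"
  by (auto simp: smooth_fun_on_def Cinf_on_def comp_def Ck_on_const)

lemma open_chart_image:
  assumes "smooth_manifold \<A>" "(V, \<phi>) \<in> \<A>" "open U"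
  shows "open (\<phi> ` (U \<inter> V))"
proof -
  have V: "open V" "open (\<phi> ` V)" "homeomorphism V (\<phi> ` V) \<phi> (inv_into V \<phi>)"
    using assms(1,2) unfolding smooth_manifold_def by blast+
  have "openin (top_of_set (\<phi> ` V)) (\<phi> ` (U \<inter> V))"
    by (rule homeomorphism_imp_open_map[OF V(3)]) (use assms V in \<open>auto simp: openin_open\<close>)
  then show ?thesis using V(2) by (metis openin_open_eq)
qed

lemma chart_inv_into:
  assumes "smooth_manifold \<A>" "(V, \<phi>) \<in> \<A>" "p \<in> \<phi> ` (U \<inter> V)"
  shows "inv_into V \<phi> p \<in> U"
proof -
  have "homeomorphism V (\<phi> ` V) \<phi> (inv_into V \<phi>)"
    using assms(1,2) unfolding smooth_manifold_def by blast
  then have "\<And>y. y \<in> V \<Longrightarrow> inv_into V \<phi> (\<phi> y) = y"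
    by (simp add: homeomorphism_def)
  with assms(3) show ?thesis by auto
qed

lemma smooth_fun_on_cong:
  assumes "smooth_manifold \<A>" "open U" "smooth_fun_on \<A> U h" "\<And>x. x \<in> U \<Longrightarrow> h x = k x"
  shows "smooth_fun_on \<A> U k"
proof (rule smooth_fun_onI)
  fix V \<phi> assume V: "(V, \<phi>) \<in> \<A>"
  show "Cinf_on (\<lambda>p. k (inv_into V \<phi> p)) (\<phi> ` (U \<inter> V))"
    unfolding Cinf_on_def
  proof
    fix n
    show "Ck_on n (\<lambda>p. k (inv_into V \<phi> p)) (\<phi> ` (U \<inter> V))"
      by (rule Ck_on_cong[OF open_chart_image[OF assms(1) V assms(2)], of "\<lambda>p. h (inv_into V \<phi> p)"])
        (use smooth_fun_onD[OF assms(3) V] chart_inv_into[OF assms(1) V, of _ U] assms(4)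
          in \<open>auto simp: Cinf_on_def\<close>)
  qed
qed

lemma smooth_fun_on_add:
  assumes "smooth_manifold \<A>" "open U" "smooth_fun_on \<A> U h" "smooth_fun_on \<A> U k"
  shows "smooth_fun_on \<A> U (\<lambda>x. h x + k x)"
proof (rule smooth_fun_onI)
  fix V \<phi> assume V: "(V, \<phi>) \<in> \<A>"
  show "Cinf_on (\<lambda>p. h (inv_into V \<phi> p) + k (inv_into V \<phi> p)) (\<phi> ` (U \<inter> V))"
    using smooth_fun_onD[OF assms(3) V] smooth_fun_onD[OF assms(4) V]
    unfolding Cinf_on_def by (simp add: Ck_on_add[OF open_chart_image[OF assms(1) V assms(2)]])
qed

lemma smooth_fun_on_mult:
  assumes "smooth_manifold \<A>" "open U" "smooth_fun_on \<A> U h" "smooth_fun_on \<A> U k"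
  shows "smooth_fun_on \<A> U (\<lambda>x. h x * k x)"
proof (rule smooth_fun_onI)
  fix V \<phi> assume V: "(V, \<phi>) \<in> \<A>"
  show "Cinf_on (\<lambda>p. h (inv_into V \<phi> p) * k (inv_into V \<phi> p)) (\<phi> ` (U \<inter> V))"
    by (rule Cinf_on_mult[OF open_chart_image[OF assms(1) V assms(2)]
          smooth_fun_onD[OF assms(3) V] smooth_fun_onD[OF assms(4) V]])
qed

section \<open>Tangent vectors, curvature and frames\<close>

locale smooth_mfd =
  fixes \<A> :: "('m::{t2_space, second_countable_topology}, 'n::finite) chart set"
  assumes smooth_manifold: "smooth_manifold \<A>"
begin

abbreviation "sf \<equiv> smooth_fun_on \<A>"
abbreviation "vf \<equiv> smooth_vfield_on \<A>"
abbreviation "T \<equiv> tangent_space \<A>"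

lemmas sf_const = smooth_fun_on_const
  and sf_subset = smooth_fun_on_subset
  and sf_cong = smooth_fun_on_cong[OF smooth_manifold]
  and sf_add = smooth_fun_on_add[OF smooth_manifold]
  and sf_mult = smooth_fun_on_mult[OF smooth_manifold]

lemma sf_minus: "open W \<Longrightarrow> sf W h \<Longrightarrow> sf W (\<lambda>y. - h y)"
  using sf_mult[OF _ sf_const, of W h "-1"] by simp

lemma sf_diff: "open W \<Longrightarrow> sf W h \<Longrightarrow> sf W k \<Longrightarrow> sf W (\<lambda>y. h y - k y)"
  using sf_add[OF _ _ sf_minus, of W h k] by simp

lemma sf_sum:
  assumes "open W" "\<And>i. i \<in> I \<Longrightarrow> sf W (h i)"
  shows "sf W (\<lambda>y. \<Sum>i\<in>I. h i y)"
  using assms(2) by (induction I rule: infinite_finite_induct) (auto intro: sf_const sf_add[OF assms(1)])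

lemma smooth_nearI: "open W \<Longrightarrow> x \<in> W \<Longrightarrow> sf W h \<Longrightarrow> smooth_near \<A> x h"
  unfolding smooth_near_def by blast

context
  fixes x W v
  assumes v: "v \<in> T x" and W: "open W" "x \<in> W"
begin

lemma tvec_add: "sf W h \<Longrightarrow> sf W k \<Longrightarrow> v (\<lambda>y. h y + k y) = v h + v k"
  using v smooth_nearI[OF W] unfolding tangent_space_def by auto

lemma tvec_cmult: "sf W h \<Longrightarrow> v (\<lambda>y. c * h y) = c * v h"
  using v smooth_nearI[OF W] unfolding tangent_space_def by auto

lemma tvec_mult: "sf W h \<Longrightarrow> sf W k \<Longrightarrow> v (\<lambda>y. h y * k y) = v h * k x + h x * v k"
  using v smooth_nearI[OF W] unfolding tangent_space_def by auto

lemma tvec_cong: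
  assumes "sf W h" "\<And>y. y \<in> W \<Longrightarrow> h y = k y"
  shows "v h = v k"
proof -
  have "sf W k" by (rule sf_cong[OF W(1) assms])
  moreover have "\<forall>\<^sub>F y in nhds x. h y = k y"
    using W assms(2) unfolding eventually_nhds by blast
  ultimately show ?thesis
    using v smooth_nearI[OF W] assms(1) unfolding tangent_space_def by blast
qed

lemma tvec_const: "v (\<lambda>y. c) = 0"
proof -
  have "v (\<lambda>y. 1 * 1) = v (\<lambda>y. 1) * 1 + 1 * v (\<lambda>y. 1)"
    by (rule tvec_mult) (rule sf_const)+
  then have "v (\<lambda>y. 1) = 0" by simp
  then show ?thesis using tvec_cmult[OF sf_const, of c 1] by simp
qed

lemma tvec_minus: "sf W h \<Longrightarrow> v (\<lambda>y. - h y) = - v h"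
  using tvec_cmult[of h "-1"] by simp

lemma tvec_diff: "sf W h \<Longrightarrow> sf W k \<Longrightarrow> v (\<lambda>y. h y - k y) = v h - v k"
  using tvec_add[OF _ sf_minus[OF W(1)], of h k] tvec_minus[of k] by simp

lemma tvec_sum:
  assumes "\<And>i. i \<in> I \<Longrightarrow> sf W (h i)"
  shows "v (\<lambda>y. \<Sum>i\<in>I. h i y) = (\<Sum>i\<in>I. v (h i))"
  using assms by (induction I rule: infinite_finite_induct)
    (auto simp: tvec_const tvec_add sf_sum[OF W(1)])

end

lemma tvec_not_smooth: "v \<in> T x \<Longrightarrow> \<not> smooth_near \<A> x h \<Longrightarrow> v h = 0"
  unfolding tangent_space_def by blast

lemma T_iff:
  "v \<in> T x \<longleftrightarrow>
    (\<forall>h. \<not> smooth_near \<A> x h \<longrightarrow> v h = 0) \<and>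
    (\<forall>h. smooth_near \<A> x h \<longrightarrow> (\<forall>k. smooth_near \<A> x k \<longrightarrow>
      ((\<forall>\<^sub>F y in nhds x. h y = k y) \<longrightarrow> v h = v k) \<and>
      v (\<lambda>y. h y + k y) = v h + v k \<and>
      v (\<lambda>y. h y * k y) = v h * k x + h x * v k)) \<and>
    (\<forall>h. smooth_near \<A> x h \<longrightarrow> (\<forall>c. v (\<lambda>y. c * h y) = c * v h))"
  unfolding tangent_space_def mem_Collect_eq by meson

lemma T_dest:
  assumes "v \<in> T x" "smooth_near \<A> x h" "smooth_near \<A> x k"
  shows "v (\<lambda>y. h y + k y) = v h + v k"
    and "v (\<lambda>y. h y * k y) = v h * k x + h x * v k"
    and "v (\<lambda>y. c * h y) = c * v h"
  using assms unfolding T_iff by blast+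

lemma T_add:
  assumes "v \<in> T x" "w \<in> T x"
  shows "(\<lambda>h. v h + w h) \<in> T x"
  unfolding T_iff
proof (intro conjI allI impI)
  fix h k c
  assume h: "smooth_near \<A> x h"
  show "v (\<lambda>y. c * h y) + w (\<lambda>y. c * h y) = c * (v h + w h)"
    using assms h by (simp add: T_dest algebra_simps)
  assume k: "smooth_near \<A> x k"
  show "v (\<lambda>y. h y + k y) + w (\<lambda>y. h y + k y) = v h + w h + (v k + w k)"
    "v (\<lambda>y. h y * k y) + w (\<lambda>y. h y * k y) = (v h + w h) * k x + h x * (v k + w k)"
    using assms h k by (simp_all add: T_dest algebra_simps)
  show "\<forall>\<^sub>F y in nhds x. h y = k y \<Longrightarrow> v h + w h = v k + w k"
    using assms h k unfolding T_iff by metis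
next
  show "\<not> smooth_near \<A> x h \<Longrightarrow> v h + w h = 0" for h
    using assms by (simp add: tvec_not_smooth)
qed

lemma T_scale:
  assumes "v \<in> T x"
  shows "(\<lambda>h. c * v h) \<in> T x"
  unfolding T_iff
proof (intro conjI allI impI)
  fix h k a
  assume h: "smooth_near \<A> x h"
  show "c * v (\<lambda>y. a * h y) = a * (c * v h)"
    using assms h by (simp add: T_dest)
  assume k: "smooth_near \<A> x k"
  show "c * v (\<lambda>y. h y + k y) = c * v h + c * v k"
    "c * v (\<lambda>y. h y * k y) = c * v h * k x + h x * (c * v k)"
    using assms h k by (simp_all add: T_dest algebra_simps)
  show "\<forall>\<^sub>F y in nhds x. h y = k y \<Longrightarrow> c * v h = c * v k"
    using assms h k unfolding T_iff by metis
next
  show "\<not> smooth_near \<A> x h \<Longrightarrow> c * v h = 0" for h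
    using assms by (simp add: tvec_not_smooth)
qed

lemma T_zero: "(\<lambda>h. 0) \<in> T x"
  unfolding tangent_space_def by simp

lemma T_sum: "(\<And>i. i \<in> I \<Longrightarrow> v i \<in> T x) \<Longrightarrow> (\<lambda>h. \<Sum>i\<in>I. v i h) \<in> T x"
  by (induction I rule: infinite_finite_induct) (auto intro: T_zero T_add)

lemma T_diff: "v \<in> T x \<Longrightarrow> w \<in> T x \<Longrightarrow> (\<lambda>h. v h - w h) \<in> T x"
  using T_add[OF _ T_scale, of v x w "-1"] by simp

lemma vf_T: "vf W X \<Longrightarrow> x \<in> W \<Longrightarrow> X x \<in> T x"
  unfolding smooth_vfield_on_def by blast

lemma vf_apply: "vf W X \<Longrightarrow> open W \<Longrightarrow> sf W h \<Longrightarrow> sf W (\<lambda>x. X x h)"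
  unfolding smooth_vfield_on_def by blast

lemma vf_subset: "vf W X \<Longrightarrow> V \<subseteq> W \<Longrightarrow> vf V X"
  unfolding smooth_vfield_on_def by (meson subset_iff subset_trans)

lemma vf_cong:
  assumes "vf W X" "\<And>x. x \<in> W \<Longrightarrow> X x = Y x"
  shows "vf W Y"
  unfolding smooth_vfield_on_def
proof (intro conjI allI impI ballI)
  show "Y x \<in> T x" if "x \<in> W" for x
    using assms that unfolding smooth_vfield_on_def by metis
  fix V h assume *: "open V \<and> V \<subseteq> W \<and> sf V h"
  show "sf V (\<lambda>x. Y x h)"
    by (rule sf_cong[of _ "\<lambda>x. X x h"]) (use * assms in \<open>auto simp: smooth_vfield_on_def\<close>)
qed

lemma vf_add: "vf W X \<Longrightarrow> vf W Y \<Longrightarrow> vf W (\<lambda>y h. X y h + Y y h)"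
  unfolding smooth_vfield_on_def by (auto intro: T_add sf_add)

lemma vf_scale:
  assumes "vf W X" "sf W k"
  shows "vf W (\<lambda>y h. k y * X y h)"
  using assms unfolding smooth_vfield_on_def
  by (auto intro!: T_scale sf_mult intro: sf_subset)

lemma vf_diff: "vf W X \<Longrightarrow> vf W Y \<Longrightarrow> vf W (\<lambda>y h. X y h - Y y h)"
  using vf_add[OF _ vf_scale[OF _ sf_const], of W X Y "-1"] by simp

lemma vf_zero: "vf W (\<lambda>y h. 0)"
  unfolding smooth_vfield_on_def by (auto intro: T_zero sf_const)

lemma vf_sum: "(\<And>i. i \<in> I \<Longrightarrow> vf W (X i)) \<Longrightarrow> vf W (\<lambda>y h. \<Sum>i\<in>I. X i y h)"
  by (induction I rule: infinite_finite_induct) (auto intro: vf_zero vf_add)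

lemma lie_bracket_apply:
  "open W \<Longrightarrow> x \<in> W \<Longrightarrow> sf W h \<Longrightarrow>
    lie_bracket \<A> X Y x h = X x (\<lambda>y. Y y h) - Y x (\<lambda>y. X y h)"
  unfolding lie_bracket_def using smooth_nearI by simp

text \<open>Expanded, each double bracket consists of four third-order derivatives of
  \<open>h\<close>, and the cyclic sum cancels them in pairs. If \<open>h\<close> is not smooth near
  \<open>x\<close>, every bracket has the default value 0.\<close>

lemma jacobi:
  assumes W: "open W" "x \<in> W" and vf: "vf W X" "vf W Y" "vf W Z"
  shows "lie_bracket \<A> X (lie_bracket \<A> Y Z) x h + lie_bracket \<A> Y (lie_bracket \<A> Z X) x h
    + lie_bracket \<A> Z (lie_bracket \<A> X Y) x h = 0"
proof (cases "smooth_near \<A> x h")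
  case True
  then obtain V0 where V0: "open V0" "x \<in> V0" "sf V0 h"
    unfolding smooth_near_def by blast
  \<comment> \<open>\<open>h\<close> need not be smooth on all of \<open>W\<close>; a tangent vector
    sees only the germ at \<open>x\<close>, so everything may be restricted.\<close>
  define V where "V = W \<inter> V0"
  have V: "open V" "x \<in> V" "sf V h" "vf V X" "vf V Y" "vf V Z"
    using W V0 vf unfolding V_def by (auto intro: sf_subset vf_subset)
  have nested: "lie_bracket \<A> X (lie_bracket \<A> Y Z) x h =
      X x (\<lambda>y. Y y (\<lambda>z. Z z h)) - X x (\<lambda>y. Z y (\<lambda>z. Y z h))
      - (Y x (\<lambda>y. Z y (\<lambda>z. X z h)) - Z x (\<lambda>y. Y y (\<lambda>z. X z h)))"
    if XYZ: "vf V X" "vf V Y" "vf V Z" for X Y Z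
  proof -
    note apply_sf = vf_apply[OF XYZ(1) V(1)] vf_apply[OF XYZ(2) V(1)] vf_apply[OF XYZ(3) V(1)]
    have "X x (\<lambda>y. lie_bracket \<A> Y Z y h) =
        X x (\<lambda>y. Y y (\<lambda>z. Z z h) - Z y (\<lambda>z. Y z h))"
      by (rule tvec_cong[OF vf_T[OF XYZ(1) V(2)] V(1,2), symmetric])
        (simp_all add: sf_diff apply_sf V lie_bracket_apply[OF V(1) _ V(3)])
    also have "\<dots> = X x (\<lambda>y. Y y (\<lambda>z. Z z h)) - X x (\<lambda>y. Z y (\<lambda>z. Y z h))"
      by (rule tvec_diff[OF vf_T[OF XYZ(1) V(2)] V(1,2)]) (simp_all add: apply_sf V)
    finally show ?thesis
      using lie_bracket_apply[OF V(1,2) apply_sf(1)[OF V(3)], of Y Z]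
      by (simp add: lie_bracket_apply[OF V(1-3)])
  qed
  show ?thesis
    using nested[OF V(4,5,6)] nested[OF V(5,6,4)] nested[OF V(6,4,5)] by simp
qed (simp add: lie_bracket_def)

text \<open>Linearity over smooth functions for germs of fields at \<open>x\<close>, required on
  every neighbourhood because frames in a metric trace may have any domain. The third clause is
  locality: it replaces the extension of local fields by cutoff functions.\<close>

definition tensorial_at :: "'m \<Rightarrow> ('m vfield \<Rightarrow> 'b::real_vector) \<Rightarrow> bool" where
  "tensorial_at x B \<longleftrightarrow> (\<forall>W. open W \<and> x \<in> W \<longrightarrow>
     (\<forall>X Y. vf W X \<and> vf W Y \<longrightarrow> B (\<lambda>y h. X y h + Y y h) = B X + B Y) \<and>
     (\<forall>k X. sf W k \<and> vf W X \<longrightarrow> B (\<lambda>y h. k y * X y h) = k x *\<^sub>R B X) \<and>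
     (\<forall>X Y. vf W X \<and> (\<forall>y\<in>W. X y = Y y) \<longrightarrow> B X = B Y))"

text \<open>Smooth fields stay smooth on smaller sets, so testing inside one neighbourhood
  suffices.\<close>

lemma tensorial_atI:
  assumes U: "open U" "x \<in> U"
    and add: "\<And>W X Y. open W \<Longrightarrow> x \<in> W \<Longrightarrow> W \<subseteq> U \<Longrightarrow> vf W X \<Longrightarrow> vf W Y \<Longrightarrow>
      B (\<lambda>y h. X y h + Y y h) = B X + B Y"
    and scale: "\<And>W k X. open W \<Longrightarrow> x \<in> W \<Longrightarrow> W \<subseteq> U \<Longrightarrow> sf W k \<Longrightarrow> vf W X \<Longrightarrow>
      B (\<lambda>y h. k y * X y h) = k x *\<^sub>R B X"
    and cong: "\<And>W X Y. open W \<Longrightarrow> x \<in> W \<Longrightarrow> W \<subseteq> U \<Longrightarrow> vf W X \<Longrightarrow> (\<And>y. y \<in> W \<Longrightarrow> X y = Y y) \<Longrightarrow>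
      B X = B Y"
  shows "tensorial_at x B"
  unfolding tensorial_at_def
proof (intro allI impI conjI)
  fix W assume W: "open W \<and> x \<in> W"
  then have I: "open (W \<inter> U)" "x \<in> W \<inter> U" "W \<inter> U \<subseteq> U" "W \<inter> U \<subseteq> W" using U by auto
  show "B (\<lambda>y h. X y h + Y y h) = B X + B Y" if "vf W X \<and> vf W Y" for X Y
    using that by (intro add[OF I(1-3)]) (auto intro: vf_subset)
  show "B (\<lambda>y h. k y * X y h) = k x *\<^sub>R B X" if "sf W k \<and> vf W X" for k X
    using that by (intro scale[OF I(1-3)]) (auto intro: vf_subset sf_subset)
  show "B X = B Y" if "vf W X \<and> (\<forall>y\<in>W. X y = Y y)" for X Y
    using that by (intro cong[OF I(1-3)]) (auto intro: vf_subset)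
qed

lemma
  assumes "tensorial_at x B" "open W" "x \<in> W"
  shows tensorial_add: "vf W X \<Longrightarrow> vf W Y \<Longrightarrow> B (\<lambda>y h. X y h + Y y h) = B X + B Y"
    and tensorial_scale: "sf W k \<Longrightarrow> vf W X \<Longrightarrow> B (\<lambda>y h. k y * X y h) = k x *\<^sub>R B X"
    and tensorial_cong: "vf W X \<Longrightarrow> (\<And>y. y \<in> W \<Longrightarrow> X y = Y y) \<Longrightarrow> B X = B Y"
proof -
  have *: "(\<forall>X Y. vf W X \<and> vf W Y \<longrightarrow> B (\<lambda>y h. X y h + Y y h) = B X + B Y) \<and>
      (\<forall>k X. sf W k \<and> vf W X \<longrightarrow> B (\<lambda>y h. k y * X y h) = k x *\<^sub>R B X) \<and>
      (\<forall>X Y. vf W X \<and> (\<forall>y\<in>W. X y = Y y) \<longrightarrow> B X = B Y)"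
    using assms(1)[unfolded tensorial_at_def, rule_format, OF conjI[OF assms(2,3)]] .
  show "vf W X \<Longrightarrow> vf W Y \<Longrightarrow> B (\<lambda>y h. X y h + Y y h) = B X + B Y"
    using * by simp
  show "sf W k \<Longrightarrow> vf W X \<Longrightarrow> B (\<lambda>y h. k y * X y h) = k x *\<^sub>R B X"
    using * by simp
  show "vf W X \<Longrightarrow> (\<And>y. y \<in> W \<Longrightarrow> X y = Y y) \<Longrightarrow> B X = B Y"
    using conjunct2[OF conjunct2[OF *]] by blast
qed

lemma tensorial_sum:
  assumes "tensorial_at x B" "open W" "x \<in> W" "\<And>i. i \<in> I \<Longrightarrow> vf W (X i)"
  shows "B (\<lambda>y h. \<Sum>i\<in>I. X i y h) = (\<Sum>i\<in>I. B (X i))"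
proof -
  have zero: "B (\<lambda>y h. 0) = 0"
    using tensorial_scale[OF assms(1-3) sf_const vf_zero, of 0] by simp
  show ?thesis
    using assms(4) by (induction I rule: infinite_finite_induct)
      (auto simp: zero tensorial_add[OF assms(1-3)] vf_sum)
qed

end

section \<open>The metric, the Levi-Civita connection and its curvature\<close>

locale riemannian_mfd = smooth_mfd \<A>
  for \<A> :: "('m::{t2_space, second_countable_topology}, 'n::finite) chart set" +
  fixes g :: "'m metric" and nabla :: "'m connection"
  assumes riemannian_metric: "riemannian_metric \<A> g"
    and levi_civita: "levi_civita \<A> g nabla"
begin

lemmas metric_axioms = riemannian_metric[unfolded riemannian_metric_def]

lemma g_sym: "u \<in> T x \<Longrightarrow> v \<in> T x \<Longrightarrow> g x u v = g x v u"
  using metric_axioms[THEN conjunct1] by blast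

lemma g_add: "u \<in> T x \<Longrightarrow> v \<in> T x \<Longrightarrow> w \<in> T x \<Longrightarrow> g x (\<lambda>h. u h + v h) w = g x u w + g x v w"
  using metric_axioms[THEN conjunct2, THEN conjunct1] by simp

lemma g_scale: "v \<in> T x \<Longrightarrow> w \<in> T x \<Longrightarrow> g x (\<lambda>h. c * v h) w = c * g x v w"
  using metric_axioms[THEN conjunct2, THEN conjunct2, THEN conjunct1] by simp

lemma g_smooth: "open W \<Longrightarrow> vf W X \<Longrightarrow> vf W Y \<Longrightarrow> sf W (\<lambda>x. g x (X x) (Y x))"
  using metric_axioms[THEN conjunct2, THEN conjunct2, THEN conjunct2, THEN conjunct2] by simp

lemma g_diff: "u \<in> T x \<Longrightarrow> v \<in> T x \<Longrightarrow> w \<in> T x \<Longrightarrow> g x (\<lambda>h. u h - v h) w = g x u w - g x v w"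
  using g_add[of u x "\<lambda>h. (-1) * v h" w] g_scale[of v x w "-1"] T_scale[of v x "-1"] by simp

lemma g_zero: "w \<in> T x \<Longrightarrow> g x (\<lambda>h. 0) w = 0"
  using g_scale[OF T_zero, of w x 0] by simp

lemma g_sum:
  assumes "\<And>i. i \<in> I \<Longrightarrow> v i \<in> T x" "w \<in> T x"
  shows "g x (\<lambda>h. \<Sum>i\<in>I. v i h) w = (\<Sum>i\<in>I. g x (v i) w)"
  using assms(1) by (induction I rule: infinite_finite_induct)
    (auto simp: g_zero[OF assms(2)] g_add[OF _ _ assms(2)] T_sum)

lemma affine: "affine_connection \<A> nabla"
  using levi_civita unfolding levi_civita_def by blast

context
  fixes W :: "'m set" assumes W: "open W"
begin

lemmas nabla_axioms = affine[unfolded affine_connection_def, THEN spec, THEN mp, OF W]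

lemma nabla_vf: "vf W X \<Longrightarrow> vf W Y \<Longrightarrow> vf W (nabla X Y)"
  using nabla_axioms[THEN conjunct1] by simp

lemma nabla_cong:
  assumes "vf W X" "vf W Y" "\<And>y. y \<in> W \<Longrightarrow> X' y = X y" "\<And>y. y \<in> W \<Longrightarrow> Y' y = Y y" "x \<in> W"
  shows "nabla X' Y' x = nabla X Y x"
  using nabla_axioms[THEN conjunct2, THEN conjunct1, rule_format, of X Y X' Y' x] assms by simp

lemma nabla_add1:
  "vf W X \<Longrightarrow> vf W X' \<Longrightarrow> vf W Y \<Longrightarrow> x \<in> W \<Longrightarrow>
    nabla (\<lambda>y h. X y h + X' y h) Y x = (\<lambda>h. nabla X Y x h + nabla X' Y x h)"
  using nabla_axioms[THEN conjunct2, THEN conjunct2, THEN conjunct1] by simp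

lemma nabla_scale1:
  "sf W k \<Longrightarrow> vf W X \<Longrightarrow> vf W Y \<Longrightarrow> x \<in> W \<Longrightarrow>
    nabla (\<lambda>y h. k y * X y h) Y x = (\<lambda>h. k x * nabla X Y x h)"
  using nabla_axioms[THEN conjunct2, THEN conjunct2, THEN conjunct2, THEN conjunct1] by simp

lemma nabla_add2:
  "vf W X \<Longrightarrow> vf W Y \<Longrightarrow> vf W Y' \<Longrightarrow> x \<in> W \<Longrightarrow>
    nabla X (\<lambda>y h. Y y h + Y' y h) x = (\<lambda>h. nabla X Y x h + nabla X Y' x h)"
  using nabla_axioms[THEN conjunct2, THEN conjunct2, THEN conjunct2, THEN conjunct2, THEN conjunct1] by simp

lemma nabla_scale2:
  "sf W k \<Longrightarrow> vf W X \<Longrightarrow> vf W Y \<Longrightarrow> x \<in> W \<Longrightarrow>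
    nabla X (\<lambda>y h. k y * Y y h) x = (\<lambda>h. X x k * Y x h + k x * nabla X Y x h)"
  using nabla_axioms[THEN conjunct2, THEN conjunct2, THEN conjunct2, THEN conjunct2, THEN conjunct2] by simp

lemma torsion_free:
  "vf W X \<Longrightarrow> vf W Y \<Longrightarrow> x \<in> W \<Longrightarrow> lie_bracket \<A> X Y x = (\<lambda>h. nabla X Y x h - nabla Y X x h)"
  using levi_civita[unfolded levi_civita_def, THEN conjunct2, THEN conjunct1] W by simp

lemma metric_compatible:
  "vf W X \<Longrightarrow> vf W Y \<Longrightarrow> vf W Z \<Longrightarrow> x \<in> W \<Longrightarrow>
    X x (\<lambda>y. g y (Y y) (Z y)) = g x (nabla X Y x) (Z x) + g x (Y x) (nabla X Z x)"
  using levi_civita[unfolded levi_civita_def, THEN conjunct2, THEN conjunct2] W by blast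

text \<open>Torsion-freeness writes the bracket as a difference of covariant derivatives. Its
  smoothness, and the rules for it below, are thus inherited from the connection.\<close>

lemma lie_bracket_vf: "vf W X \<Longrightarrow> vf W Y \<Longrightarrow> vf W (lie_bracket \<A> X Y)"
  by (rule vf_cong[OF vf_diff[OF nabla_vf nabla_vf]]) (simp_all add: torsion_free)

lemma lie_bracket_add1:
  "vf W X \<Longrightarrow> vf W X' \<Longrightarrow> vf W Y \<Longrightarrow> x \<in> W \<Longrightarrow>
    lie_bracket \<A> (\<lambda>y h. X y h + X' y h) Y x = (\<lambda>h. lie_bracket \<A> X Y x h + lie_bracket \<A> X' Y x h)"
  by (simp add: torsion_free vf_add nabla_add1 nabla_add2 fun_eq_iff)

lemma lie_bracket_scale1:
  "sf W k \<Longrightarrow> vf W X \<Longrightarrow> vf W Y \<Longrightarrow> x \<in> W \<Longrightarrow>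
    lie_bracket \<A> (\<lambda>y h. k y * X y h) Y x = (\<lambda>h. k x * lie_bracket \<A> X Y x h + (- Y x k) * X x h)"
  by (simp add: torsion_free vf_scale nabla_scale1 nabla_scale2 fun_eq_iff algebra_simps)

lemma lie_bracket_cong:
  assumes "vf W X" "vf W Y" "\<And>y. y \<in> W \<Longrightarrow> X' y = X y" "\<And>y. y \<in> W \<Longrightarrow> Y' y = Y y" "x \<in> W"
  shows "lie_bracket \<A> X' Y' x = lie_bracket \<A> X Y x"
proof -
  have "vf W X'" "vf W Y'"
    using vf_cong[OF assms(1), of X'] vf_cong[OF assms(2), of Y'] assms(3,4) by auto
  then show ?thesis
    using assms by (simp add: torsion_free nabla_cong[OF assms(1-5)] nabla_cong[OF assms(2,1,4,3,5)])
qed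

lemma curvature_vf: "vf W X \<Longrightarrow> vf W Y \<Longrightarrow> vf W Z \<Longrightarrow> vf W (curvature \<A> nabla X Y Z)"
  unfolding curvature_def by (intro vf_diff nabla_vf lie_bracket_vf)

lemma curvature_cong:
  assumes "vf W X" "vf W Y" "vf W Z" "x \<in> W"
    "\<And>y. y \<in> W \<Longrightarrow> X' y = X y" "\<And>y. y \<in> W \<Longrightarrow> Y' y = Y y" "\<And>y. y \<in> W \<Longrightarrow> Z' y = Z y"
  shows "curvature \<A> nabla X' Y' Z' x = curvature \<A> nabla X Y Z x"
proof -
  have "nabla X' (nabla Y' Z') x = nabla X (nabla Y Z) x"
    "nabla Y' (nabla X' Z') x = nabla Y (nabla X Z) x"
    "nabla (lie_bracket \<A> X' Y') Z' x = nabla (lie_bracket \<A> X Y) Z x"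
    by (intro nabla_cong lie_bracket_cong nabla_vf lie_bracket_vf assms; assumption)+
  then show ?thesis unfolding curvature_def by simp
qed

lemma curvature_antisym:
  assumes "vf W X" "vf W Y" "vf W Z" "x \<in> W"
  shows "curvature \<A> nabla Y X Z x h = - curvature \<A> nabla X Y Z x h"
proof -
  have "nabla (lie_bracket \<A> Y X) Z x = nabla (\<lambda>y h. (-1) * lie_bracket \<A> X Y y h) Z x"
    by (rule nabla_cong[OF vf_scale[OF lie_bracket_vf sf_const]])
      (simp_all add: assms torsion_free[OF assms(1,2)] torsion_free[OF assms(2,1)])
  then show ?thesis
    using nabla_scale1[OF sf_const lie_bracket_vf[OF assms(1,2)] assms(3,4), of "-1"]
    unfolding curvature_def by simp
qed

lemma curvature_add1:
  assumes "vf W X" "vf W X'" "vf W Y" "vf W Z" "x \<in> W"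
  shows "curvature \<A> nabla (\<lambda>y h. X y h + X' y h) Y Z x =
    (\<lambda>h. curvature \<A> nabla X Y Z x h + curvature \<A> nabla X' Y Z x h)"
proof -
  have "nabla Y (nabla (\<lambda>y h. X y h + X' y h) Z) x = nabla Y (\<lambda>y h. nabla X Z y h + nabla X' Z y h) x"
    by (rule nabla_cong) (auto intro: vf_add nabla_vf assms simp: nabla_add1[OF assms(1,2,4)])
  moreover have "nabla (lie_bracket \<A> (\<lambda>y h. X y h + X' y h) Y) Z x =
      nabla (\<lambda>y h. lie_bracket \<A> X Y y h + lie_bracket \<A> X' Y y h) Z x"
    by (rule nabla_cong) (auto intro: vf_add lie_bracket_vf assms simp: lie_bracket_add1[OF assms(1,2,3)])
  ultimately show ?thesis
    unfolding curvature_def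
    by (simp add: nabla_add1 nabla_add2 nabla_vf lie_bracket_vf assms fun_eq_iff)
qed

text \<open>Two terms contain the derivative of \<open>k\<close> along \<open>Y\<close>: one from
  the outer derivative along \<open>Y\<close>, one from the bracket of k X with Y. They
  cancel.\<close>

lemma curvature_scale1:
  assumes "sf W k" "vf W X" "vf W Y" "vf W Z" "x \<in> W"
  shows "curvature \<A> nabla (\<lambda>y h. k y * X y h) Y Z x = (\<lambda>h. k x * curvature \<A> nabla X Y Z x h)"
proof -
  have Yk: "sf W (\<lambda>y. - Y y k)"
    by (rule sf_minus[OF W vf_apply[OF assms(3) W assms(1)]])
  have "nabla Y (nabla (\<lambda>y h. k y * X y h) Z) x = nabla Y (\<lambda>y h. k y * nabla X Z y h) x"
    by (rule nabla_cong) (auto intro: vf_scale nabla_vf assms simp: nabla_scale1[OF assms(1,2,4)])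
  moreover have "nabla (lie_bracket \<A> (\<lambda>y h. k y * X y h) Y) Z x =
      nabla (\<lambda>y h. k y * lie_bracket \<A> X Y y h + (- Y y k) * X y h) Z x"
    by (rule nabla_cong[OF vf_add[OF vf_scale vf_scale]])
      (auto intro: lie_bracket_vf Yk assms simp: lie_bracket_scale1[OF assms(1,2,3)])
  moreover have "\<dots> = (\<lambda>h. k x * nabla (lie_bracket \<A> X Y) Z x h + (- Y x k) * nabla X Z x h)"
    using nabla_add1[OF vf_scale[OF lie_bracket_vf[OF assms(2,3)] assms(1)] vf_scale[OF assms(2) Yk] assms(4,5)]
      nabla_scale1[OF assms(1) lie_bracket_vf[OF assms(2,3)] assms(4,5)] nabla_scale1[OF Yk assms(2,4,5)]
    by simp
  ultimately show ?thesis
    unfolding curvature_def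
    by (simp add: nabla_scale1 nabla_scale2 nabla_vf assms fun_eq_iff algebra_simps)
qed

lemma curvature_add3:
  assumes "vf W X" "vf W Y" "vf W Z" "vf W Z'" "x \<in> W"
  shows "curvature \<A> nabla X Y (\<lambda>y h. Z y h + Z' y h) x =
    (\<lambda>h. curvature \<A> nabla X Y Z x h + curvature \<A> nabla X Y Z' x h)"
proof -
  have "nabla V (nabla V' (\<lambda>y h. Z y h + Z' y h)) x = (\<lambda>h. nabla V (nabla V' Z) x h + nabla V (nabla V' Z') x h)"
    if V: "vf W V" "vf W V'" for V V'
  proof -
    have "nabla V (nabla V' (\<lambda>y h. Z y h + Z' y h)) x = nabla V (\<lambda>y h. nabla V' Z y h + nabla V' Z' y h) x"
      by (rule nabla_cong) (auto intro: vf_add nabla_vf assms V simp: nabla_add2[OF V(2) assms(3,4)])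
    then show ?thesis by (simp add: nabla_add2 nabla_vf assms V)
  qed
  then show ?thesis
    unfolding curvature_def by (simp add: nabla_add2 lie_bracket_vf assms fun_eq_iff)
qed

text \<open>The mixed first-order terms are symmetric in \<open>X\<close> and \<open>Y\<close>, and
  the second derivatives of \<open>k\<close> antisymmetrise to the derivative along the bracket,
  which the last term of the curvature removes.\<close>

lemma curvature_scale3:
  assumes "sf W k" "vf W X" "vf W Y" "vf W Z" "x \<in> W"
  shows "curvature \<A> nabla X Y (\<lambda>y h. k y * Z y h) x = (\<lambda>h. k x * curvature \<A> nabla X Y Z x h)"
proof -
  have "nabla V (nabla V' (\<lambda>y h. k y * Z y h)) x h =
      V x (\<lambda>y. V' y k) * Z x h + V' x k * nabla V Z x h + V x k * nabla V' Z x h + k x * nabla V (nabla V' Z) x h"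
    if V: "vf W V" "vf W V'" for V V' h
  proof -
    have sfV: "sf W (\<lambda>y. V' y k)" by (rule vf_apply[OF V(2) W assms(1)])
    have "nabla V (nabla V' (\<lambda>y h. k y * Z y h)) x =
        nabla V (\<lambda>y h. V' y k * Z y h + k y * nabla V' Z y h) x"
      by (rule nabla_cong[OF V(1) vf_add[OF vf_scale[OF assms(4) sfV]
              vf_scale[OF nabla_vf[OF V(2) assms(4)] assms(1)]]])
        (simp_all add: nabla_scale2[OF assms(1) V(2) assms(4)] assms)
    also have "\<dots> = (\<lambda>h. nabla V (\<lambda>y h. V' y k * Z y h) x h + nabla V (\<lambda>y h. k y * nabla V' Z y h) x h)"
      by (intro nabla_add2 vf_scale nabla_vf assms V sfV)
    finally show ?thesis
      by (simp add: nabla_scale2 nabla_vf sfV V assms)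
  qed
  then show ?thesis
    unfolding curvature_def
    by (simp add: nabla_scale2 lie_bracket_vf assms fun_eq_iff lie_bracket_apply[OF W] algebra_simps)
qed

text \<open>Torsion-freeness, applied once inside and once outside, turns each group of three terms
  in the cyclic sum into a double bracket; the Jacobi identity does the rest.\<close>

lemma first_bianchi:
  assumes vf: "vf W X" "vf W Y" "vf W Z" and x: "x \<in> W"
  shows "curvature \<A> nabla X Y Z x h + curvature \<A> nabla Y Z X x h + curvature \<A> nabla Z X Y x h = 0"
proof -
  have *: "nabla X (nabla Y Z) x h - nabla X (nabla Z Y) x h - nabla (lie_bracket \<A> Y Z) X x h =
      lie_bracket \<A> X (lie_bracket \<A> Y Z) x h" if vf: "vf W X" "vf W Y" "vf W Z" for X Y Z
  proof -
    have "nabla X (nabla Y Z) x = nabla X (\<lambda>y h. lie_bracket \<A> Y Z y h + nabla Z Y y h) x"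
      by (rule nabla_cong) (auto intro: vf_add lie_bracket_vf nabla_vf vf simp: torsion_free vf x)
    then have "nabla X (nabla Y Z) x h = nabla X (lie_bracket \<A> Y Z) x h + nabla X (nabla Z Y) x h"
      by (simp add: nabla_add2 lie_bracket_vf nabla_vf vf x)
    then show ?thesis
      by (simp add: torsion_free[of X "lie_bracket \<A> Y Z"] lie_bracket_vf vf x)
  qed
  show ?thesis
    using *[OF vf] *[OF vf(2,3,1)] *[OF vf(3,1,2)] jacobi[OF W x vf, of h]
    unfolding curvature_def by simp
qed

end

text \<open>Pairing with a fixed vector makes the values real. The first slot is the one traced by
  Ricci, the other two are those traced by the scalar curvature.\<close>

lemma tensorial_curvature:
  assumes W: "open W" "x \<in> W" and vf: "vf W Y" "vf W Z" and v: "v \<in> T x"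
  shows "tensorial_at x (\<lambda>X. g x (curvature \<A> nabla X Y Z x) v)"
    and "tensorial_at x (\<lambda>X. g x (curvature \<A> nabla Y X Z x) v)"
    and "tensorial_at x (\<lambda>X. g x (curvature \<A> nabla Y Z X x) v)"
proof -
  show 1: "tensorial_at x (\<lambda>X. g x (curvature \<A> nabla X Y Z x) v)"
  proof (rule tensorial_atI[OF W])
    fix V assume V: "open V" "x \<in> V" "V \<subseteq> W"
    note vfV = vf[THEN vf_subset, OF V(3)]
    note cT = vf_T[OF curvature_vf[OF V(1) _ vfV] V(2)]
    show "g x (curvature \<A> nabla (\<lambda>y h. X y h + X' y h) Y Z x) v =
        g x (curvature \<A> nabla X Y Z x) v + g x (curvature \<A> nabla X' Y Z x) v"
      if "vf V X" "vf V X'" for X X'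
      using that by (simp add: curvature_add1[OF V(1) _ _ vfV V(2)] g_add cT v)
    show "g x (curvature \<A> nabla (\<lambda>y h. k y * X y h) Y Z x) v =
        k x *\<^sub>R g x (curvature \<A> nabla X Y Z x) v"
      if "sf V k" "vf V X" for k X
      using that by (simp add: curvature_scale1[OF V(1) _ _ vfV V(2)] g_scale cT v)
    show "g x (curvature \<A> nabla X Y Z x) v = g x (curvature \<A> nabla X' Y Z x) v"
      if "vf V X" "\<And>y. y \<in> V \<Longrightarrow> X y = X' y" for X X'
      using that curvature_cong[OF V(1) that(1) vfV V(2), of X' Y Z] by simp
  qed
  show "tensorial_at x (\<lambda>X. g x (curvature \<A> nabla Y X Z x) v)"
  proof (rule tensorial_atI[OF W])
    fix V assume V: "open V" "x \<in> V" "V \<subseteq> W"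
    note vfV = vf[THEN vf_subset, OF V(3)]
    \<comment> \<open>Antisymmetry reduces the second slot to the first on smooth fields, which is
      all that is tested.\<close>
    have flip: "g x (curvature \<A> nabla Y X Z x) v = - g x (curvature \<A> nabla X Y Z x) v"
      if X: "vf V X" for X
    proof -
      have "curvature \<A> nabla Y X Z x = (\<lambda>h. (-1) * curvature \<A> nabla X Y Z x h)"
        using curvature_antisym[OF V(1) X vfV V(2)] by (simp add: fun_eq_iff)
      then show ?thesis
        using g_scale[OF vf_T[OF curvature_vf[OF V(1) X vfV] V(2)] v, of "-1"] by simp
    qed
    show "g x (curvature \<A> nabla Y (\<lambda>y h. X y h + X' y h) Z x) v =
        g x (curvature \<A> nabla Y X Z x) v + g x (curvature \<A> nabla Y X' Z x) v"
      if "vf V X" "vf V X'" for X X'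
      using that tensorial_add[OF 1 V(1,2) that] by (simp add: flip vf_add)
    show "g x (curvature \<A> nabla Y (\<lambda>y h. k y * X y h) Z x) v =
        k x *\<^sub>R g x (curvature \<A> nabla Y X Z x) v"
      if "sf V k" "vf V X" for k X
      using that tensorial_scale[OF 1 V(1,2) that] by (simp add: flip vf_scale)
    show "g x (curvature \<A> nabla Y X Z x) v = g x (curvature \<A> nabla Y X' Z x) v"
      if "vf V X" "\<And>y. y \<in> V \<Longrightarrow> X y = X' y" for X X'
      using that curvature_cong[OF V(1) vfV(1) that(1) vfV(2) V(2), of Y X' Z] by simp
  qed
  show "tensorial_at x (\<lambda>X. g x (curvature \<A> nabla Y Z X x) v)"
  proof (rule tensorial_atI[OF W])
    fix V assume V: "open V" "x \<in> V" "V \<subseteq> W"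
    note vfV = vf[THEN vf_subset, OF V(3)]
    note cT = vf_T[OF curvature_vf[OF V(1) vfV] V(2)]
    show "g x (curvature \<A> nabla Y Z (\<lambda>y h. X y h + X' y h) x) v =
        g x (curvature \<A> nabla Y Z X x) v + g x (curvature \<A> nabla Y Z X' x) v"
      if "vf V X" "vf V X'" for X X'
      using that by (simp add: curvature_add3[OF V(1) vfV _ _ V(2)] g_add cT v)
    show "g x (curvature \<A> nabla Y Z (\<lambda>y h. k y * X y h) x) v =
        k x *\<^sub>R g x (curvature \<A> nabla Y Z X x) v"
      if "sf V k" "vf V X" for k X
      using that by (simp add: curvature_scale3[OF V(1) _ vfV _ V(2)] g_scale cT v)
    show "g x (curvature \<A> nabla Y Z X x) v = g x (curvature \<A> nabla Y Z X' x) v"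
      if "vf V X" "\<And>y. y \<in> V \<Longrightarrow> X y = X' y" for X X'
      using that curvature_cong[OF V(1) vfV that(1) V(2), of Y Z X'] by simp
  qed
qed

lemma tensorial_g: "v \<in> T x \<Longrightarrow> tensorial_at x (\<lambda>X. g x (X x) v)"
  unfolding tensorial_at_def by (auto simp: g_add g_scale vf_T)

lemma tensorial_g_right:
  assumes "v \<in> T x" shows "tensorial_at x (\<lambda>X. g x v (X x))"
  unfolding tensorial_at_def
  by (auto simp: g_sym[OF assms] g_add g_scale vf_T assms T_add T_scale)

text \<open>Meant for Ricci: as a definite description it is known to equal a sum over a frame only
  when its arguments are smooth.\<close>

lemma tensorial_at_restrict:
  assumes "tensorial_at x B'" "\<And>W X. open W \<Longrightarrow> x \<in> W \<Longrightarrow> vf W X \<Longrightarrow> B X = B' X"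
  shows "tensorial_at x B"
proof (rule tensorial_atI[OF open_UNIV UNIV_I])
  fix W assume W: "open W" "x \<in> W"
  show "B (\<lambda>y h. X y h + Y y h) = B X + B Y" if "vf W X" "vf W Y" for X Y
    using that assms(2)[OF W] tensorial_add[OF assms(1) W] by (simp add: vf_add)
  show "B (\<lambda>y h. k y * X y h) = k x *\<^sub>R B X" if "sf W k" "vf W X" for k X
    using that assms(2)[OF W] tensorial_scale[OF assms(1) W] by (simp add: vf_scale)
  show "B X = B Y" if *: "vf W X" "\<And>y. y \<in> W \<Longrightarrow> X y = Y y" for X Y
    using assms(2)[OF W *(1)] assms(2)[OF W vf_cong[OF *]] tensorial_cong[OF assms(1) W *] by simp
qed

lemma tensorial_at_sum:
  "(\<And>i. i \<in> I \<Longrightarrow> tensorial_at x (B i)) \<Longrightarrow> tensorial_at x (\<lambda>X. \<Sum>i\<in>I. B i X)"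
  unfolding tensorial_at_def
  by (auto simp: sum.distrib scaleR_sum_right intro!: sum.cong)

text \<open>In the second argument the product rule for the derivation and that for
  \<open>nabla\<close> produce the same term with the derivative of \<open>k\<close>, and the
  Hessian is their difference.\<close>

lemma tensorial_hessian:
  assumes W: "open W" "x \<in> W" and X: "vf W X" and f: "sf W f"
  shows "tensorial_at x (\<lambda>Y. hessian nabla f Y X x)" "tensorial_at x (\<lambda>Y. hessian nabla f X Y x)"
proof -
  show "tensorial_at x (\<lambda>Y. hessian nabla f Y X x)"
  proof (rule tensorial_atI[OF W])
    fix V assume V: "open V" "x \<in> V" "V \<subseteq> W"
    note XV = vf_subset[OF X V(3)]
    show "hessian nabla f (\<lambda>y h. Y y h + Z y h) X x = hessian nabla f Y X x + hessian nabla f Z X x"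
      if "vf V Y" "vf V Z" for Y Z
      using that by (simp add: hessian_def nabla_add1[OF V(1) _ _ XV V(2)])
    show "hessian nabla f (\<lambda>y h. k y * Y y h) X x = k x *\<^sub>R hessian nabla f Y X x"
      if "sf V k" "vf V Y" for k Y
      using that by (simp add: hessian_def nabla_scale1[OF V(1) _ _ XV V(2)] algebra_simps)
    show "hessian nabla f Y X x = hessian nabla f Z X x"
      if "vf V Y" "\<And>y. y \<in> V \<Longrightarrow> Y y = Z y" for Y Z
      using that nabla_cong[OF V(1) that(1) XV _ _ V(2), of Z X] V(2) by (simp add: hessian_def)
  qed
  show "tensorial_at x (\<lambda>Y. hessian nabla f X Y x)"
  proof (rule tensorial_atI[OF W])
    fix V assume V: "open V" "x \<in> V" "V \<subseteq> W"
    note XV = vf_subset[OF X V(3)] and fV = sf_subset[OF f V(3)]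
    note D = vf_T[OF XV V(2)]
    show "hessian nabla f X (\<lambda>y h. Y y h + Z y h) x = hessian nabla f X Y x + hessian nabla f X Z x"
      if "vf V Y" "vf V Z" for Y Z
      using that tvec_add[OF D V(1,2) vf_apply[OF that(1) V(1) fV] vf_apply[OF that(2) V(1) fV]]
      by (simp add: hessian_def nabla_add2[OF V(1) XV _ _ V(2)])
    show "hessian nabla f X (\<lambda>y h. k y * Y y h) x = k x *\<^sub>R hessian nabla f X Y x"
      if "sf V k" "vf V Y" for k Y
      using that tvec_mult[OF D V(1,2) that(1) vf_apply[OF that(2) V(1) fV]]
      by (simp add: hessian_def nabla_scale2[OF V(1) _ XV _ V(2)] algebra_simps)
    show "hessian nabla f X Y x = hessian nabla f X Z x"
      if "vf V Y" "\<And>y. y \<in> V \<Longrightarrow> Y y = Z y" for Y Z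
      using that nabla_cong[OF V(1) XV that(1) _ _ V(2), of X Z]
        tvec_cong[OF D V(1,2) vf_apply[OF that(1) V(1) fV], of "\<lambda>y. Z y f"]
      by (simp add: hessian_def)
  qed
qed

lemma hessian_symmetric:
  assumes W: "open W" "x \<in> W" and vf: "vf W X" "vf W Y" and f: "sf W f"
  shows "hessian nabla f X Y x = hessian nabla f Y X x"
  using lie_bracket_apply[OF W f, of X Y] torsion_free[OF W(1) vf W(2)]
  by (simp add: hessian_def)

end

section \<open>Orthonormal frames and the evaluation of metric traces\<close>

locale framed_mfd = riemannian_mfd \<A> g nabla
  for \<A> :: "('m::{t2_space, second_countable_topology}, 'n::finite) chart set"
    and g :: "'m metric" and nabla :: "'m connection" +
  fixes U :: "'m set" and e :: "'n \<Rightarrow> 'm vfield"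
  assumes frame: "orthonormal_frame \<A> g U e"
begin

lemma frame_open: "open U"
  using frame unfolding orthonormal_frame_def by simp

lemma frame_vf: "vf U (e a)"
  using frame unfolding orthonormal_frame_def by simp

lemma frame_vf_subset: "W \<subseteq> U \<Longrightarrow> vf W (e a)"
  using vf_subset[OF frame_vf] .

lemma frame_T: "x \<in> U \<Longrightarrow> e a x \<in> T x"
  using vf_T[OF frame_vf] .

lemma frame_orthonormal: "x \<in> U \<Longrightarrow> g x (e a x) (e b x) = (if a = b then 1 else 0)"
  using frame unfolding orthonormal_frame_def by simp

lemma frame_expand:
  assumes x: "x \<in> U" and v: "v \<in> T x"
  shows "v = (\<lambda>h. \<Sum>a\<in>UNIV. g x v (e a x) * e a x h)"
proof -
  obtain c where c: "v = (\<lambda>h. \<Sum>a\<in>UNIV. c a * e a x h)"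
    using frame x v unfolding orthonormal_frame_def by blast
  have "g x v (e b x) = (\<Sum>a\<in>UNIV. c a * g x (e a x) (e b x))" for b
    unfolding c by (simp add: g_sum T_scale frame_T x g_scale)
  then have "g x v (e b x) = c b" for b
    by (simp add: frame_orthonormal[OF x] if_distrib[of "(*) _"] cong: if_cong)
  with c show ?thesis by simp
qed

lemma g_expand:
  assumes x: "x \<in> U" and T: "v \<in> T x" "w \<in> T x"
  shows "g x v w = (\<Sum>a\<in>UNIV. g x v (e a x) * g x w (e a x))"
proof -
  have "g x v w = g x (\<lambda>h. \<Sum>a\<in>UNIV. g x v (e a x) * e a x h) w"
    using frame_expand[OF x T(1)] by simp
  also have "\<dots> = (\<Sum>a\<in>UNIV. g x v (e a x) * g x (e a x) w)"
    by (simp add: g_sum T_scale frame_T x g_scale T)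
  finally show ?thesis
    using g_sym[OF frame_T[OF x] T(2)] by simp
qed

text \<open>Locality allows \<open>X\<close> to be replaced by its frame expansion on all of
  \<open>W\<close>; the coefficient functions then come out as their values at
  \<open>x\<close>.\<close>

lemma tensorial_expand:
  assumes B: "tensorial_at x B" and W: "open W" "x \<in> W" "W \<subseteq> U" and X: "vf W X"
  shows "B X = (\<Sum>a\<in>UNIV. g x (X x) (e a x) *\<^sub>R B (e a))"
proof -
  note eW = frame_vf_subset[OF W(3)]
  note cW = g_smooth[OF W(1) X eW]
  have "B X = B (\<lambda>y h. \<Sum>a\<in>UNIV. g y (X y) (e a y) * e a y h)"
    by (rule tensorial_cong[OF B W(1,2) X]) (use W(3) frame_expand vf_T[OF X] in blast)
  also have "\<dots> = (\<Sum>a\<in>UNIV. B (\<lambda>y h. g y (X y) (e a y) * e a y h))"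
    by (rule tensorial_sum[OF B W(1,2)]) (rule vf_scale[OF eW cW])
  also have "\<dots> = (\<Sum>a\<in>UNIV. g x (X x) (e a x) *\<^sub>R B (e a))"
    by (intro sum.cong refl tensorial_scale[OF B W(1,2) cW eW])
  finally show ?thesis .
qed

text \<open>Two orthonormal frames differ at \<open>x\<close> by an orthogonal matrix, under which
  the diagonal sum of a bilinear form is invariant. Bilinearity enters as tensoriality in each
  argument with the other held smooth near \<open>x\<close>.\<close>

lemma metric_trace_eq:
  assumes x: "x \<in> U"
    and B1: "\<And>W Y. open W \<Longrightarrow> x \<in> W \<Longrightarrow> vf W Y \<Longrightarrow> tensorial_at x (\<lambda>X. B X Y)"
    and B2: "\<And>W X. open W \<Longrightarrow> x \<in> W \<Longrightarrow> vf W X \<Longrightarrow> tensorial_at x (B X)"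
  shows "metric_trace \<A> g x B = (\<Sum>a\<in>UNIV. B (e a) (e a))"
  unfolding metric_trace_def
proof (rule the_equality)
  show "\<forall>U' e'. orthonormal_frame \<A> g U' e' \<and> x \<in> U' \<longrightarrow>
    (\<Sum>a\<in>UNIV. B (e a) (e a)) = (\<Sum>a\<in>UNIV. B (e' a) (e' a))"
  proof (intro allI impI, elim conjE)
    fix U' e' assume e': "orthonormal_frame \<A> g U' e'" and x': "x \<in> U'"
    interpret F': framed_mfd \<A> g nabla U' e' by unfold_locales (rule e')
    let ?c = "\<lambda>a b. g x (e' a x) (e b x)"
    have W: "open (U \<inter> U')" "x \<in> U \<inter> U'" "U \<inter> U' \<subseteq> U"
      using frame_open F'.frame_open x x' by auto
    have e'W: "vf (U \<inter> U') (e' a)" for a by (rule F'.frame_vf_subset) simp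
    have "B (e' a) (e' a) = (\<Sum>b\<in>UNIV. \<Sum>d\<in>UNIV. (?c a b * ?c a d) *\<^sub>R B (e b) (e d))" for a
    proof -
      have "B (e' a) (e' a) = (\<Sum>b\<in>UNIV. ?c a b *\<^sub>R B (e b) (e' a))"
        by (rule tensorial_expand[OF B1[OF W(1,2) e'W] W e'W])
      moreover have "B (e b) (e' a) = (\<Sum>d\<in>UNIV. ?c a d *\<^sub>R B (e b) (e d))" for b
        by (rule tensorial_expand[OF B2[OF frame_open x frame_vf] W e'W])
      ultimately show ?thesis by (simp add: scaleR_sum_right)
    qed
    then have "(\<Sum>a\<in>UNIV. B (e' a) (e' a)) =
        (\<Sum>a\<in>UNIV. \<Sum>b\<in>UNIV. \<Sum>d\<in>UNIV. (?c a b * ?c a d) *\<^sub>R B (e b) (e d))"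
      by simp
    also have "\<dots> = (\<Sum>b\<in>UNIV. \<Sum>d\<in>UNIV. \<Sum>a\<in>UNIV. (?c a b * ?c a d) *\<^sub>R B (e b) (e d))"
      by (subst sum.swap, rule sum.cong[OF refl], rule sum.swap)
    also have "\<dots> = (\<Sum>b\<in>UNIV. \<Sum>d\<in>UNIV. (\<Sum>a\<in>UNIV. ?c a b * ?c a d) *\<^sub>R B (e b) (e d))"
      by (simp add: scaleR_sum_left)
    also have "\<dots> = (\<Sum>b\<in>UNIV. \<Sum>d\<in>UNIV. (if b = d then 1 else 0) *\<^sub>R B (e b) (e d))"
    proof -
      \<comment> \<open>Orthogonality of the transition matrix: the inner product of two vectors of
        \<open>e\<close>, expanded in the frame \<open>e'\<close>.\<close>
      have "(\<Sum>a\<in>UNIV. ?c a b * ?c a d) = g x (e b x) (e d x)" for b d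
        unfolding F'.g_expand[OF x' frame_T[OF x] frame_T[OF x]]
        by (simp add: g_sym[OF frame_T[OF x] F'.frame_T[OF x']])
      then show ?thesis by (simp add: frame_orthonormal[OF x])
    qed
    finally show "(\<Sum>a\<in>UNIV. B (e a) (e a)) = (\<Sum>a\<in>UNIV. B (e' a) (e' a))"
      by (simp add: if_distrib[of "\<lambda>t. t *\<^sub>R _"] cong: if_cong)
  qed
\<comment> \<open>Uniqueness: the frame \<open>e\<close> is itself among those quantified over, so
  any candidate equals its sum.\<close>
qed (use frame x in blast)

lemma gradient_eq:
  assumes x: "x \<in> U"
  shows "gradient \<A> g f x = (\<lambda>h. \<Sum>a\<in>UNIV. e a x f * e a x h)" (is "_ = ?v")
  unfolding gradient_def
proof (rule the_equality)
  have T: "?v \<in> T x" by (intro T_sum T_scale frame_T x)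
  have "g x ?v w = w f" if w: "w \<in> T x" for w
  proof -
    have "g x ?v w = (\<Sum>a\<in>UNIV. e a x f * g x (e a x) w)"
      by (simp add: g_sum T_scale frame_T x g_scale w)
    also have "\<dots> = (\<Sum>a\<in>UNIV. g x w (e a x) * e a x f)"
      by (simp add: g_sym[OF w frame_T[OF x]] mult.commute)
    finally show ?thesis using frame_expand[OF x w] by metis
  qed
  with T show "?v \<in> T x \<and> (\<forall>w\<in>T x. g x ?v w = w f)" by blast
  fix v assume v: "v \<in> T x \<and> (\<forall>w\<in>T x. g x v w = w f)"
  then show "v = ?v"
    using frame_expand[OF x, of v] frame_T[OF x] by simp
qed

lemma g_gradient:
  assumes x: "x \<in> U"
  shows "g x (gradient \<A> g f x) (e a x) = e a x f"
  unfolding gradient_eq[OF x]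
  by (simp add: g_sum T_scale frame_T x g_scale frame_orthonormal[OF x] if_distrib[of "(*) _"] cong: if_cong)

lemma gradient_T: "x \<in> U \<Longrightarrow> gradient \<A> g f x \<in> T x"
  by (simp add: gradient_eq T_sum T_scale frame_T)

lemma gradient_vf:
  assumes "sf U f" shows "vf U (gradient \<A> g f)"
proof (rule vf_cong)
  show "vf U (\<lambda>x h. \<Sum>a\<in>UNIV. e a x f * e a x h)"
    by (rule vf_sum) (rule vf_scale[OF frame_vf vf_apply[OF frame_vf frame_open assms]])
qed (simp add: gradient_eq)

lemma norm_gradient:
  assumes x: "x \<in> U"
  shows "g x (gradient \<A> g f x) (gradient \<A> g f x) = (\<Sum>a\<in>UNIV. (e a x f)\<^sup>2)"
  unfolding g_expand[OF x gradient_T[OF x] gradient_T[OF x]]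
  by (simp add: g_gradient[OF x] power2_eq_square)

section \<open>Connection coefficients and curvature in the frame\<close>

definition \<omega> :: "'m vfield \<Rightarrow> 'n \<Rightarrow> 'n \<Rightarrow> 'm \<Rightarrow> real" where
  "\<omega> X a b y = g y (nabla X (e a) y) (e b y)"

context
  fixes W :: "'m set" assumes W: "open W" "W \<subseteq> U"
begin

lemma omega_sf: "vf W X \<Longrightarrow> sf W (\<omega> X a b)"
  unfolding \<omega>_def by (rule g_smooth[OF W(1) nabla_vf[OF W(1) _ frame_vf_subset[OF W(2)]] frame_vf_subset[OF W(2)]])

lemma nabla_frame_T: "vf W X \<Longrightarrow> x \<in> W \<Longrightarrow> nabla X (e a) x \<in> T x"
  by (rule vf_T[OF nabla_vf[OF W(1) _ frame_vf_subset[OF W(2)]]])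

text \<open>The metric coefficients of an orthonormal frame are constant, so metric compatibility
  gives 0 for their derivative.\<close>

lemma omega_antisym:
  assumes X: "vf W X" and x: "x \<in> W"
  shows "\<omega> X a b x = - \<omega> X b a x"
proof -
  note eW = frame_vf_subset[OF W(2)]
  have xU: "x \<in> U" using x W(2) by blast
  have "X x (\<lambda>y. g y (e a y) (e b y)) = X x (\<lambda>y. if a = b then 1 else 0)"
    by (rule tvec_cong[OF vf_T[OF X x] W(1) x g_smooth[OF W(1) eW eW]])
      (use W(2) frame_orthonormal in blast)
  then have "g x (nabla X (e a) x) (e b x) + g x (e a x) (nabla X (e b) x) = 0"
    using metric_compatible[OF W(1) X eW eW x] tvec_const[OF vf_T[OF X x] W(1) x] by simp
  then show ?thesis
    using g_sym[OF frame_T[OF xU] nabla_frame_T[OF X x]] by (simp add: \<omega>_def)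
qed

text \<open>Cartan's second structure equation. Its quadratic term comes from g(nabla_Y e_a, nabla_X
  e_b) expanded in the frame, and has the shape of the matrix commutator in
  \<open>spin_action_commutator\<close>.\<close>

lemma curvature_frame:
  assumes vf: "vf W X" "vf W Y" and x: "x \<in> W"
  shows "g x (curvature \<A> nabla X Y (e a) x) (e b x) =
    X x (\<omega> Y a b) - Y x (\<omega> X a b)
    + (\<Sum>c\<in>UNIV. \<omega> X a c x * \<omega> Y b c x - \<omega> Y a c x * \<omega> X b c x)
    - \<omega> (lie_bracket \<A> X Y) a b x"
proof -
  note eW = frame_vf_subset[OF W(2)] and nv = nabla_vf[OF W(1)]
  have xU: "x \<in> U" using x W(2) by blast
  have *: "g x (nabla X (nabla Y (e a)) x) (e b x) = X x (\<omega> Y a b) - (\<Sum>c\<in>UNIV. \<omega> Y a c x * \<omega> X b c x)"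
    if "vf W X" "vf W Y" for X Y
    using metric_compatible[OF W(1) that(1) nv[OF that(2) eW] eW x, of a b]
      g_expand[OF xU nabla_frame_T[OF that(2) x] nabla_frame_T[OF that(1) x], of a b]
    by (simp add: \<omega>_def[abs_def])
  have T: "nabla X (nabla Y (e a)) x \<in> T x" if "vf W X" "vf W Y" for X Y
    by (rule vf_T[OF nv[OF that(1) nv[OF that(2) eW]] x])
  have "g x (curvature \<A> nabla X Y (e a) x) (e b x) =
      g x (nabla X (nabla Y (e a)) x) (e b x) - g x (nabla Y (nabla X (e a)) x) (e b x)
      - \<omega> (lie_bracket \<A> X Y) a b x"
    unfolding curvature_def \<omega>_def
    by (simp add: g_diff T_diff T vf nabla_frame_T[OF lie_bracket_vf[OF W(1) vf] x] frame_T[OF xU])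
  then show ?thesis
    by (simp add: * vf sum_subtractf)
qed

text \<open>In the structure equation each term inherits antisymmetry from \<open>\<omega>\<close>;
  no second derivatives of the metric have to be commuted.\<close>

lemma curvature_frame_antisym:
  assumes vf: "vf W X" "vf W Y" and x: "x \<in> W"
  shows "g x (curvature \<A> nabla X Y (e a) x) (e b x) = - g x (curvature \<A> nabla X Y (e b) x) (e a x)"
proof -
  have minus: "V x (\<omega> V' a b) = - V x (\<omega> V' b a)" if V: "vf W V" "vf W V'" for V V'
  proof -
    have "V x (\<omega> V' a b) = V x (\<lambda>y. - \<omega> V' b a y)"
      by (rule tvec_cong[OF vf_T[OF V(1) x] W(1) x omega_sf[OF V(2)]]) (rule omega_antisym[OF V(2)])
    then show ?thesis
      by (simp add: tvec_minus[OF vf_T[OF V(1) x] W(1) x omega_sf[OF V(2)]])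
  qed
  show ?thesis
    unfolding curvature_frame[OF assms] minus[OF vf] minus[OF vf(2,1)]
      omega_antisym[OF lie_bracket_vf[OF W(1) vf] x, of a b]
    by (simp add: sum_subtractf mult.commute)
qed

end

lemma lie_bracket_frame:
  assumes x: "x \<in> U"
  shows "lie_bracket \<A> (e c) (e d) x = (\<lambda>h. \<Sum>b\<in>UNIV. (\<omega> (e c) d b x - \<omega> (e d) c b x) * e b x h)"
proof -
  have T: "nabla (e a) (e b) x \<in> T x" for a b
    by (rule nabla_frame_T[OF frame_open order_refl frame_vf x])
  show ?thesis
    unfolding torsion_free[OF frame_open frame_vf frame_vf x]
    by (subst frame_expand[OF x T[of c d]], subst frame_expand[OF x T[of d c]])
      (simp add: \<omega>_def sum_subtractf left_diff_distrib)
qed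

lemma algebraic_curvature:
  assumes x: "x \<in> U"
  shows "algebraic_curvature (\<lambda>c d a b. g x (curvature \<A> nabla (e c) (e d) (e a) x) (e b x))"
proof
  note vf = frame_vf and o = frame_open
  have T: "curvature \<A> nabla (e c) (e d) (e a) x \<in> T x" for c d a
    by (rule vf_T[OF curvature_vf[OF o vf vf vf] x])
  fix c d a b
  have "curvature \<A> nabla (e c) (e d) (e a) x = (\<lambda>h. (-1) * curvature \<A> nabla (e d) (e c) (e a) x h)"
    by (rule ext) (simp add: curvature_antisym[OF o vf[of d] vf[of c] vf[of a] x])
  then show "g x (curvature \<A> nabla (e c) (e d) (e a) x) (e b x) =
      - g x (curvature \<A> nabla (e d) (e c) (e a) x) (e b x)"
    using g_scale[OF T frame_T[OF x], of "-1"] by simp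
  show "g x (curvature \<A> nabla (e c) (e d) (e a) x) (e b x) =
      - g x (curvature \<A> nabla (e c) (e d) (e b) x) (e a x)"
    by (rule curvature_frame_antisym[OF o order_refl vf vf x])
  have "(\<lambda>h. curvature \<A> nabla (e c) (e d) (e a) x h + curvature \<A> nabla (e d) (e a) (e c) x h
      + curvature \<A> nabla (e a) (e c) (e d) x h) = (\<lambda>h. 0)"
    using first_bianchi[OF o vf vf vf x] by simp
  from arg_cong[OF this, of "\<lambda>v. g x v (e b x)"]
  show "g x (curvature \<A> nabla (e c) (e d) (e a) x) (e b x) + g x (curvature \<A> nabla (e d) (e a) (e c) x) (e b x)
      + g x (curvature \<A> nabla (e a) (e c) (e d) x) (e b x) = 0"
    by (simp add: g_add T T_add frame_T[OF x] g_zero)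
qed

section \<open>Laplacian, Ricci and scalar curvature as sums over the frame\<close>

lemma laplacian_eq:
  assumes x: "x \<in> U" and f: "sf U f"
  shows "laplacian \<A> g nabla f x = (\<Sum>a\<in>UNIV. hessian nabla f (e a) (e a) x)"
  unfolding laplacian_def
proof (rule metric_trace_eq[OF x])
  fix W X assume W: "open W" "x \<in> W" and X: "vf W X"
  have WU: "open (W \<inter> U)" "x \<in> W \<inter> U" "vf (W \<inter> U) X" "sf (W \<inter> U) f"
    using W X x f frame_open by (auto intro: vf_subset sf_subset)
  show "tensorial_at x (\<lambda>Y. hessian nabla f Y X x)" "tensorial_at x (\<lambda>Y. hessian nabla f X Y x)"
    by (rule tensorial_hessian[OF WU])+
qed

text \<open>General smooth \<open>Y\<close> and \<open>Z\<close> are allowed, because the outer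
  trace of the scalar curvature needs tensoriality of Ricci, and that is read off from this
  sum.\<close>

lemma ricci_eq:
  assumes x: "x \<in> U" and W: "open W" "x \<in> W" and vf: "vf W Y" "vf W Z"
  shows "ricci \<A> g nabla Y Z x = (\<Sum>b\<in>UNIV. g x (curvature \<A> nabla (e b) Y Z x) (e b x))"
  unfolding ricci_def
proof (rule metric_trace_eq[OF x])
  fix V X assume V: "open V" "x \<in> V" and X: "vf V X"
  show "tensorial_at x (\<lambda>V. g x (curvature \<A> nabla V Y Z x) (X x))"
    by (rule tensorial_curvature(1)[OF W vf vf_T[OF X V(2)]])
  have I: "open (V \<inter> W)" "x \<in> V \<inter> W" "vf (V \<inter> W) X" "vf (V \<inter> W) Y" "vf (V \<inter> W) Z"
    using V W X vf by (auto intro: vf_subset)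
  show "tensorial_at x (\<lambda>V. g x (curvature \<A> nabla X Y Z x) (V x))"
    by (rule tensorial_g_right[OF vf_T[OF curvature_vf[OF I(1,3,4,5)] I(2)]])
qed

lemma scalar_curvature_eq:
  assumes x: "x \<in> U"
  shows "scalar_curvature \<A> g nabla x =
    (\<Sum>a\<in>UNIV. \<Sum>b\<in>UNIV. g x (curvature \<A> nabla (e b) (e a) (e a) x) (e b x))"
proof -
  have "scalar_curvature \<A> g nabla x = (\<Sum>a\<in>UNIV. ricci \<A> g nabla (e a) (e a) x)"
    unfolding scalar_curvature_def
  proof (rule metric_trace_eq[OF x])
    fix W X assume W: "open W" "x \<in> W" and X: "vf W X"
    have WU: "open (W \<inter> U)" "x \<in> W \<inter> U" "vf (W \<inter> U) X" "\<And>a. vf (W \<inter> U) (e a)"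
      using W X x frame_open by (auto intro: vf_subset frame_vf_subset)
    have meet: "open (V \<inter> W)" "x \<in> V \<inter> W" "vf (V \<inter> W) X" "vf (V \<inter> W) Y"
      if "open V" "x \<in> V" "vf V Y" for V Y
      using W X that by (auto intro: vf_subset)
    show "tensorial_at x (\<lambda>Y. ricci \<A> g nabla Y X x)"
      by (rule tensorial_at_restrict[OF tensorial_at_sum[OF
            tensorial_curvature(2)[OF WU(1,2,4,3) frame_T[OF x]]]])
        (rule ricci_eq[OF x meet(1,2,4,3)])
    show "tensorial_at x (\<lambda>Y. ricci \<A> g nabla X Y x)"
      by (rule tensorial_at_restrict[OF tensorial_at_sum[OF
            tensorial_curvature(3)[OF WU(1,2,4,3) frame_T[OF x]]]])
        (rule ricci_eq[OF x meet(1,2,3,4)])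
  qed
  then show ?thesis
    by (simp add: ricci_eq[OF x frame_open x frame_vf frame_vf])
qed

end

section \<open>Spinors\<close>

lemma clifford_action_matrix:
  fixes \<gamma> :: "'n::finite \<Rightarrow> complex ^ 's ^ 's::finite"
  assumes "spinor_representation \<gamma>"
  shows "clifford_action (\<lambda>a v. \<gamma> a *v v)"
proof (rule clifford_action.intro)
  have r: "\<gamma> a ** \<gamma> b + \<gamma> b ** \<gamma> a = (if a = b then (- 2) *\<^sub>R mat 1 else 0)" for a b
    using assms unfolding spinor_representation_def by blast
  show "linear ((*v) (\<gamma> a))" for a
    by (rule linearI) (simp_all add: vec_eq_iff matrix_vector_mult_def distrib_left sum.distrib scaleR_sum_right)
  show "\<gamma> a *v (\<gamma> b *v v) + \<gamma> b *v (\<gamma> a *v v) = (if a = b then - 2 *\<^sub>R v else 0)" for a b v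
  proof -
    have scale: "(c *\<^sub>R A) *v v = c *\<^sub>R (A *v v)" for c and A :: "complex ^ 's ^ 's"
      by (simp add: vec_eq_iff matrix_vector_mult_def scaleR_sum_right)
    have "(\<gamma> a ** \<gamma> b + \<gamma> b ** \<gamma> a) *v v = (if a = b then - 2 *\<^sub>R v else 0)"
      using scale[of "- 2" "mat 1"] by (simp add: r)
    then show ?thesis by (simp add: matrix_vector_mul_assoc matrix_vector_mult_add_rdistrib)
  qed
qed

section \<open>Smooth spinor-valued functions and their derivatives\<close>

context smooth_mfd
begin

definition sv :: "'m set \<Rightarrow> ('m \<Rightarrow> complex ^ 's::finite) \<Rightarrow> bool" where
  "sv W F \<longleftrightarrow> (\<forall>k. smooth_cfun_on \<A> W (\<lambda>x. F x $ k))"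

lemma svI: "(\<And>k. sf W (\<lambda>x. Re (F x $ k))) \<Longrightarrow> (\<And>k. sf W (\<lambda>x. Im (F x $ k))) \<Longrightarrow> sv W F"
  unfolding sv_def smooth_cfun_on_def by blast

lemma sv_Re: "sv W F \<Longrightarrow> sf W (\<lambda>x. Re (F x $ k))" and sv_Im: "sv W F \<Longrightarrow> sf W (\<lambda>x. Im (F x $ k))"
  unfolding sv_def smooth_cfun_on_def by blast+

lemma sv_subset: "sv W F \<Longrightarrow> V \<subseteq> W \<Longrightarrow> sv V F"
  by (blast intro: svI sf_subset sv_Re sv_Im)

text \<open>Derivations act on real functions only, so complex matrix products are split before they
  are differentiated.\<close>

lemma Re_Im_mult_vec:
  "Re ((M *v v) $ k) = (\<Sum>j\<in>UNIV. Re (M $ k $ j) * Re (v $ j) - Im (M $ k $ j) * Im (v $ j))"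
  "Im ((M *v v) $ k) = (\<Sum>j\<in>UNIV. Re (M $ k $ j) * Im (v $ j) + Im (M $ k $ j) * Re (v $ j))"
  by (simp_all add: matrix_vector_mult_def)

context
  fixes W :: "'m set" assumes W: "open W"
begin

lemma sv_add: "sv W F \<Longrightarrow> sv W G \<Longrightarrow> sv W (\<lambda>y. F y + G y)"
  by (rule svI) (auto intro: sf_add[OF W] sv_Re sv_Im)

lemma sv_scale: "sf W h \<Longrightarrow> sv W F \<Longrightarrow> sv W (\<lambda>y. h y *\<^sub>R F y)"
  by (rule svI) (auto intro: sf_mult[OF W] sv_Re sv_Im)

lemma sv_diff: "sv W F \<Longrightarrow> sv W G \<Longrightarrow> sv W (\<lambda>y. F y - G y)"
  using sv_add[OF _ sv_scale[OF sf_const], of F G "-1"] by simp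

lemma sv_zero: "sv W (\<lambda>y. 0)"
  by (rule svI) (simp_all add: sf_const)

lemma sv_sum: "(\<And>i. i \<in> I \<Longrightarrow> sv W (F i)) \<Longrightarrow> sv W (\<lambda>y. \<Sum>i\<in>I. F i y)"
  by (induction I rule: infinite_finite_induct) (auto intro: sv_zero sv_add)

lemma sv_mult: "sv W F \<Longrightarrow> sv W (\<lambda>y. M *v F y)"
  by (rule svI; unfold Re_Im_mult_vec; intro sf_sum[OF W] sf_diff[OF W] sf_add[OF W] sf_mult[OF W] sf_const)
    (simp_all add: sv_Re sv_Im)

lemma sv_vec_deriv: "vf W X \<Longrightarrow> sv W F \<Longrightarrow> sv W (\<lambda>y. vec_deriv (X y) F)"
  by (rule svI) (simp_all add: vec_deriv_def vf_apply[OF _ W] sv_Re sv_Im)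

context
  fixes x v assumes x: "x \<in> W" and v: "v \<in> T x"
begin

lemma vec_deriv_cong: "sv W F \<Longrightarrow> (\<And>y. y \<in> W \<Longrightarrow> F y = G y) \<Longrightarrow> vec_deriv v F = vec_deriv v G"
  by (simp add: vec_deriv_def tvec_cong[OF v W x sv_Re] tvec_cong[OF v W x sv_Im] vec_eq_iff)

lemma vec_deriv_add:
  "sv W F \<Longrightarrow> sv W G \<Longrightarrow> vec_deriv v (\<lambda>y. F y + G y) = vec_deriv v F + vec_deriv v G"
  by (simp add: vec_deriv_def vec_eq_iff complex_eq_iff tvec_add[OF v W x] sv_Re sv_Im)

lemma vec_deriv_scale:
  "sf W h \<Longrightarrow> sv W F \<Longrightarrow> vec_deriv v (\<lambda>y. h y *\<^sub>R F y) = v h *\<^sub>R F x + h x *\<^sub>R vec_deriv v F"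
  by (simp add: vec_deriv_def vec_eq_iff complex_eq_iff tvec_mult[OF v W x] sv_Re sv_Im)

lemma vec_deriv_zero: "vec_deriv v (\<lambda>y. 0) = 0"
  by (simp add: vec_deriv_def vec_eq_iff complex_eq_iff tvec_const[OF v W x])

lemma vec_deriv_diff:
  "sv W F \<Longrightarrow> sv W G \<Longrightarrow> vec_deriv v (\<lambda>y. F y - G y) = vec_deriv v F - vec_deriv v G"
  by (simp add: vec_deriv_def vec_eq_iff complex_eq_iff tvec_diff[OF v W x] sv_Re sv_Im)

lemma vec_deriv_sum:
  "(\<And>i. i \<in> I \<Longrightarrow> sv W (F i)) \<Longrightarrow> vec_deriv v (\<lambda>y. \<Sum>i\<in>I. F i y) = (\<Sum>i\<in>I. vec_deriv v (F i))"
  by (induction I rule: infinite_finite_induct) (auto simp: vec_deriv_zero vec_deriv_add sv_sum)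

text \<open>\<open>M\<close> is a constant matrix. Applied to \<open>\<gamma> a\<close>, this says
  that Clifford multiplication by a frame vector is constant in the trivialisation, so the rotation
  of the frame enters only through \<open>spin_action\<close>.\<close>

lemma vec_deriv_mult:
  assumes F: "sv W F"
  shows "vec_deriv v (\<lambda>y. M *v F y) = M *v vec_deriv v F"
proof -
  note sf_terms = sf_mult[OF W sf_const sv_Re[OF F]] sf_mult[OF W sf_const sv_Im[OF F]]
  note v_terms = tvec_cmult[OF v W x sv_Re[OF F]] tvec_cmult[OF v W x sv_Im[OF F]]
  have "v (\<lambda>y. Re ((M *v F y) $ k)) = Re ((M *v vec_deriv v F) $ k)"
    "v (\<lambda>y. Im ((M *v F y) $ k)) = Im ((M *v vec_deriv v F) $ k)" for k
    unfolding Re_Im_mult_vec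
    by (simp_all add: tvec_sum[OF v W x] sf_diff[OF W] sf_add[OF W] sf_terms
        tvec_diff[OF v W x] tvec_add[OF v W x] v_terms vec_deriv_def)
  then show ?thesis by (simp add: vec_eq_iff complex_eq_iff vec_deriv_def)
qed

end

lemma vec_deriv_commutator:
  assumes vf: "vf W X" "vf W Y" and F: "sv W F" and x: "x \<in> W"
  shows "vec_deriv (X x) (\<lambda>y. vec_deriv (Y y) F) - vec_deriv (Y x) (\<lambda>y. vec_deriv (X y) F) =
    vec_deriv (lie_bracket \<A> X Y x) F"
  by (simp add: vec_deriv_def vec_eq_iff complex_eq_iff lie_bracket_apply[OF W x] sv_Re[OF F] sv_Im[OF F])

end

end

section \<open>The spin connection in the trivialisation of a frame\<close>

locale spin_framed_mfd = framed_mfd \<A> g nabla U e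
  for \<A> :: "('m::{t2_space, second_countable_topology}, 'n::finite) chart set"
    and g :: "'m metric" and nabla :: "'m connection"
    and U :: "'m set" and e :: "'n \<Rightarrow> 'm vfield" +
  fixes \<gamma> :: "'n \<Rightarrow> complex ^ 's ^ 's::finite"
  assumes spinor_representation: "spinor_representation \<gamma>"
begin

sublocale clifford_action "\<lambda>a v. \<gamma> a *v v"
  by (rule clifford_action_matrix[OF spinor_representation])

text \<open>The spin connection on one local representative instead of a compatible family, so that
  it applies to intermediate functions such as e_a acting on a derivative of the spinor.\<close>

definition snabla :: "'m vfield \<Rightarrow> ('m \<Rightarrow> complex ^ 's) \<Rightarrow> 'm \<Rightarrow> complex ^ 's" where
  "snabla X F x = vec_deriv (X x) F + spin_action (\<lambda>a b. \<omega> X a b x) (F x)"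

lemma spin_connection_eq:
  "E i = e \<Longrightarrow> spin_connection g nabla \<gamma> E X \<psi> i x = snabla X (\<psi> i) x"
  unfolding spin_connection_def snabla_def spin_action_def \<omega>_def
  by (simp add: matrix_vector_mul_assoc)

context
  fixes W :: "'m set" assumes W: "open W" "W \<subseteq> U"
begin

lemma sv_spin_action:
  "(\<And>a b. sf W (w a b)) \<Longrightarrow> sv W F \<Longrightarrow> sv W (\<lambda>y. spin_action (\<lambda>a b. w a b y) (F y))"
  unfolding spin_action_def
  by (intro sv_scale[OF W(1) sf_const] sv_sum[OF W(1)] sv_scale[OF W(1)] sv_mult[OF W(1)]) auto

lemma vec_deriv_spin_action:
  assumes w: "\<And>a b. sf W (w a b)" and F: "sv W F" and x: "x \<in> W" and v: "v \<in> T x"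
  shows "vec_deriv v (\<lambda>y. spin_action (\<lambda>a b. w a b y) (F y)) =
    spin_action (\<lambda>a b. v (w a b)) (F x) + spin_action (\<lambda>a b. w a b x) (vec_deriv v F)"
proof -
  note mF = sv_mult[OF W(1) F] and mmF = sv_mult[OF W(1) sv_mult[OF W(1) F]]
  have s1: "sv W (\<lambda>y. w a b y *\<^sub>R (\<gamma> a *v (\<gamma> b *v F y)))" for a b
    by (rule sv_scale[OF W(1) w mmF])
  have s2: "sv W (\<lambda>y. \<Sum>b\<in>UNIV. w a b y *\<^sub>R (\<gamma> a *v (\<gamma> b *v F y)))" for a
    by (rule sv_sum[OF W(1) s1])
  have s3: "sv W (\<lambda>y. \<Sum>a\<in>UNIV. \<Sum>b\<in>UNIV. w a b y *\<^sub>R (\<gamma> a *v (\<gamma> b *v F y)))"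
    by (rule sv_sum[OF W(1) s2])
  show ?thesis
    unfolding spin_action_def
    by (simp add: vec_deriv_scale[OF W(1) x v sf_const s3] tvec_const[OF v W(1) x]
        vec_deriv_sum[OF W(1) x v s2] vec_deriv_sum[OF W(1) x v s1] vec_deriv_scale[OF W(1) x v w mmF]
        vec_deriv_mult[OF W(1) x v mF] vec_deriv_mult[OF W(1) x v F] sum.distrib scaleR_add_right)
qed

lemma snabla_sv: "vf W X \<Longrightarrow> sv W F \<Longrightarrow> sv W (snabla X F)"
  unfolding snabla_def
  by (intro sv_add[OF W(1)] sv_vec_deriv[OF W(1)] sv_spin_action omega_sf[OF W]) auto

context
  fixes X x assumes X: "vf W X" and x: "x \<in> W"
begin

lemma snabla_cong: "sv W F \<Longrightarrow> (\<And>y. y \<in> W \<Longrightarrow> F y = F' y) \<Longrightarrow> snabla X F x = snabla X F' x"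
  using vec_deriv_cong[OF W(1) x vf_T[OF X x], of F F'] x by (simp add: snabla_def)

lemma snabla_add: "sv W F \<Longrightarrow> sv W F' \<Longrightarrow> snabla X (\<lambda>y. F y + F' y) x = snabla X F x + snabla X F' x"
  by (simp add: snabla_def vec_deriv_add[OF W(1) x vf_T[OF X x]] spin_action_add)

lemma snabla_diff: "sv W F \<Longrightarrow> sv W F' \<Longrightarrow> snabla X (\<lambda>y. F y - F' y) x = snabla X F x - snabla X F' x"
  by (simp add: snabla_def vec_deriv_diff[OF W(1) x vf_T[OF X x]] spin_action_diff)

lemma snabla_scale: "sf W h \<Longrightarrow> sv W F \<Longrightarrow> snabla X (\<lambda>y. h y *\<^sub>R F y) x = X x h *\<^sub>R F x + h x *\<^sub>R snabla X F x"
  by (simp add: snabla_def vec_deriv_scale[OF W(1) x vf_T[OF X x]] spin_action_scaleR scaleR_add_right)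

lemma snabla_sum:
  "(\<And>i. i \<in> I \<Longrightarrow> sv W (F i)) \<Longrightarrow> snabla X (\<lambda>y. \<Sum>i\<in>I. F i y) x = (\<Sum>i\<in>I. snabla X (F i) x)"
  by (simp add: snabla_def vec_deriv_sum[OF W(1) x vf_T[OF X x]] spin_action_sum sum.distrib)

text \<open>The product rule for Clifford multiplication: \<open>\<gamma> a\<close> has no
  derivative, and its commutator with the spin action supplies the covariant derivative of
  e_a.\<close>

lemma snabla_clifford:
  assumes F: "sv W F"
  shows "snabla X (\<lambda>y. \<gamma> a *v F y) x = (\<Sum>b\<in>UNIV. \<omega> X a b x *\<^sub>R (\<gamma> b *v F x)) + \<gamma> a *v snabla X F x"
  unfolding snabla_def vec_deriv_mult[OF W(1) x vf_T[OF X x] F]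
  by (simp add: spin_action_clifford[OF omega_antisym[OF W X x]] G_add)

end

text \<open>Derivatives of \<open>\<omega>\<close> and commutators of spin actions are the linear
  and the quadratic part of the structure equation, so together with the bracket term they form the
  spin action of the curvature.\<close>

lemma snabla_commutator:
  assumes vf: "vf W X" "vf W Y" and F: "sv W F" and x: "x \<in> W"
  shows "snabla X (snabla Y F) x - snabla Y (snabla X F) x - snabla (lie_bracket \<A> X Y) F x =
    spin_action (\<lambda>a b. g x (curvature \<A> nabla X Y (e a) x) (e b x)) (F x)"
proof -
  \<comment> \<open>The third and fourth summands are exchanged when \<open>X\<close> and
    \<open>Y\<close> are, hence cancel in the commutator.\<close>
  have *: "snabla X (snabla Y F) x = vec_deriv (X x) (\<lambda>y. vec_deriv (Y y) F)
      + spin_action (\<lambda>a b. X x (\<omega> Y a b)) (F x)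
      + spin_action (\<lambda>a b. \<omega> Y a b x) (vec_deriv (X x) F)
      + spin_action (\<lambda>a b. \<omega> X a b x) (vec_deriv (Y x) F)
      + spin_action (\<lambda>a b. \<omega> X a b x) (spin_action (\<lambda>a b. \<omega> Y a b x) (F x))"
    if vf: "vf W X" "vf W Y" for X Y
  proof -
    note D = vf_T[OF vf(1) x]
    have "vec_deriv (X x) (snabla Y F) = vec_deriv (X x) (\<lambda>y. vec_deriv (Y y) F)
        + vec_deriv (X x) (\<lambda>y. spin_action (\<lambda>a b. \<omega> Y a b y) (F y))"
      unfolding snabla_def
      by (rule vec_deriv_add[OF W(1) x D sv_vec_deriv[OF W(1) vf(2) F]
            sv_spin_action[OF omega_sf[OF W vf(2)] F]])
    then show ?thesis
      using vec_deriv_spin_action[OF omega_sf[OF W vf(2)] F x D]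
      by (simp add: snabla_def spin_action_add)
  qed
  have lin: "spin_action (\<lambda>a b. w a b + z a b) v = spin_action w v + spin_action z v"
    "spin_action (\<lambda>a b. w a b - z a b) v = spin_action w v - spin_action z v" for w z v
    unfolding spin_action_def
    by (simp_all add: scaleR_add_left scaleR_diff_left sum.distrib sum_subtractf scaleR_add_right scaleR_diff_right)
  show ?thesis
    unfolding *[OF vf] *[OF vf(2,1)] curvature_frame[OF W vf x] lin
      spin_action_commutator[OF omega_antisym[OF W vf(1) x] omega_antisym[OF W vf(2) x], symmetric]
    using vec_deriv_commutator[OF W(1) vf F x]
    by (simp add: snabla_def[of "lie_bracket \<A> X Y"] algebra_simps)
qed

text \<open>Both summands of \<open>snabla\<close> are pointwise linear in \<open>X\<close>. This
  expands the derivatives along brackets, gradients and the fields nabla_c e_d in the frame.\<close>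

lemma tensorial_snabla:
  assumes x: "x \<in> W"
  shows "tensorial_at x (\<lambda>X. snabla X F x)"
proof (rule tensorial_atI[OF W(1) x])
  fix V assume V: "open V" "x \<in> V" "V \<subseteq> W"
  have VU: "V \<subseteq> U" using V(3) W(2) by blast
  note eV = frame_vf_subset[OF VU] and xU = subsetD[OF VU V(2)]
  have lin: "spin_action (\<lambda>a b. w a b + z a b) v = spin_action w v + spin_action z v"
    "spin_action (\<lambda>a b. c * w a b) v = c *\<^sub>R spin_action w v" for w z c v
    unfolding spin_action_def
    by (simp_all add: scaleR_add_left sum.distrib scaleR_add_right scaleR_sum_right mult.left_commute)
  show "snabla (\<lambda>y h. X y h + Y y h) F x = snabla X F x + snabla Y F x" if "vf V X" "vf V Y" for X Y
  proof -
    have "\<omega> (\<lambda>y h. X y h + Y y h) a b x = \<omega> X a b x + \<omega> Y a b x" for a b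
      by (simp add: \<omega>_def nabla_add1[OF V(1) that eV V(2)] g_add nabla_frame_T[OF V(1) VU]
          that V(2) frame_T[OF xU])
    then show ?thesis
      by (simp add: snabla_def lin) (simp add: vec_deriv_def vec_eq_iff complex_eq_iff)
  qed
  show "snabla (\<lambda>y h. k y * X y h) F x = k x *\<^sub>R snabla X F x" if "sf V k" "vf V X" for k X
  proof -
    have "\<omega> (\<lambda>y h. k y * X y h) a b x = k x * \<omega> X a b x" for a b
      by (simp add: \<omega>_def nabla_scale1[OF V(1) that eV V(2)] g_scale nabla_frame_T[OF V(1) VU]
          that V(2) frame_T[OF xU])
    then show ?thesis
      by (simp add: snabla_def lin scaleR_add_right) (simp add: vec_deriv_def vec_eq_iff complex_eq_iff)
  qed
  show "snabla X F x = snabla Y F x" if "vf V X" "\<And>y. y \<in> V \<Longrightarrow> X y = Y y" for X Y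
    using that(2)[OF V(2)] nabla_cong[OF V(1) that(1) eV _ refl V(2), of Y] that(2)
    by (simp add: snabla_def \<omega>_def)
qed

end

text \<open>In the second argument, the derivative of \<open>k\<close> along \<open>X\<close> arises
  once from the outer derivative of the spinor and once from \<open>nabla\<close>; subtracting
  removes it.\<close>

lemma tensorial_spinor_hessian:
  assumes W: "open W" "W \<subseteq> U" and x: "x \<in> W" and X: "vf W X" and F: "sv W F"
  shows "tensorial_at x (\<lambda>Y. snabla Y (snabla X F) x - snabla (nabla Y X) F x)"
    and "tensorial_at x (\<lambda>Y. snabla X (snabla Y F) x - snabla (nabla X Y) F x)"
proof -
  note tN = tensorial_snabla[OF W x]
  show "tensorial_at x (\<lambda>Y. snabla Y (snabla X F) x - snabla (nabla Y X) F x)"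
  proof (rule tensorial_atI[OF W(1) x])
    fix V assume V: "open V" "x \<in> V" "V \<subseteq> W"
    note XV = vf_subset[OF X V(3)] and n = nabla_vf[OF V(1) _ vf_subset[OF X V(3)]]
    show "snabla (\<lambda>y h. Y y h + Z y h) (snabla X F) x - snabla (nabla (\<lambda>y h. Y y h + Z y h) X) F x =
        snabla Y (snabla X F) x - snabla (nabla Y X) F x + (snabla Z (snabla X F) x - snabla (nabla Z X) F x)"
      if "vf V Y" "vf V Z" for Y Z
      using tensorial_cong[OF tN V(1,2) n[OF vf_add[OF that]] nabla_add1[OF V(1) that XV]]
        tensorial_add[OF tN V(1,2) n[OF that(1)] n[OF that(2)]] tensorial_add[OF tN V(1,2) that]
      by simp
    show "snabla (\<lambda>y h. k y * Y y h) (snabla X F) x - snabla (nabla (\<lambda>y h. k y * Y y h) X) F x =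
        k x *\<^sub>R (snabla Y (snabla X F) x - snabla (nabla Y X) F x)"
      if "sf V k" "vf V Y" for k Y
      using tensorial_cong[OF tN V(1,2) n[OF vf_scale[OF that(2,1)]] nabla_scale1[OF V(1) that XV]]
        tensorial_scale[OF tN V(1,2) that(1) n[OF that(2)]] tensorial_scale[OF tN V(1,2) that]
      by (simp add: scaleR_diff_right)
    show "snabla Y (snabla X F) x - snabla (nabla Y X) F x = snabla Z (snabla X F) x - snabla (nabla Z X) F x"
      if *: "vf V Y" "\<And>y. y \<in> V \<Longrightarrow> Y y = Z y" for Y Z
      using tensorial_cong[OF tN V(1,2) n[OF *(1)], of "nabla Z X" F]
        nabla_cong[OF V(1) *(1) XV, of Z X] *(2) tensorial_cong[OF tN V(1,2) *, of "snabla X F"]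
      by simp
  qed
  show "tensorial_at x (\<lambda>Y. snabla X (snabla Y F) x - snabla (nabla X Y) F x)"
  proof (rule tensorial_atI[OF W(1) x])
    fix V assume V: "open V" "x \<in> V" "V \<subseteq> W"
    have VU: "V \<subseteq> U" using V(3) W(2) by blast
    note XV = vf_subset[OF X V(3)] and n = nabla_vf[OF V(1) vf_subset[OF X V(3)]]
      and FV = sv_subset[OF F V(3)] and tNV = tensorial_snabla[OF V(1) VU]
    show "snabla X (snabla (\<lambda>y h. Y y h + Z y h) F) x - snabla (nabla X (\<lambda>y h. Y y h + Z y h)) F x =
        snabla X (snabla Y F) x - snabla (nabla X Y) F x + (snabla X (snabla Z F) x - snabla (nabla X Z) F x)"
      if that: "vf V Y" "vf V Z" for Y Z
    proof -
      have "snabla X (snabla (\<lambda>y h. Y y h + Z y h) F) x = snabla X (\<lambda>y. snabla Y F y + snabla Z F y) x"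
        by (rule snabla_cong[OF V(1) VU XV V(2) snabla_sv[OF V(1) VU vf_add[OF that] FV]])
          (rule tensorial_add[OF tNV V(1) _ that])
      then show ?thesis
        using tensorial_cong[OF tN V(1,2) n[OF vf_add[OF that]] nabla_add2[OF V(1) XV that]]
          tensorial_add[OF tN V(1,2) n[OF that(1)] n[OF that(2)]]
          snabla_add[OF V(1) VU XV V(2) snabla_sv[OF V(1) VU that(1) FV] snabla_sv[OF V(1) VU that(2) FV]]
        by simp
    qed
    show "snabla X (snabla (\<lambda>y h. k y * Y y h) F) x - snabla (nabla X (\<lambda>y h. k y * Y y h)) F x =
        k x *\<^sub>R (snabla X (snabla Y F) x - snabla (nabla X Y) F x)"
      if that: "sf V k" "vf V Y" for k Y
    proof -
      have "snabla X (snabla (\<lambda>y h. k y * Y y h) F) x = snabla X (\<lambda>y. k y *\<^sub>R snabla Y F y) x"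
        by (rule snabla_cong[OF V(1) VU XV V(2) snabla_sv[OF V(1) VU vf_scale[OF that(2,1)] FV]])
          (rule tensorial_scale[OF tNV V(1) _ that])
      moreover have "snabla (nabla X (\<lambda>y h. k y * Y y h)) F x =
          snabla (\<lambda>y h. X y k * Y y h + k y * nabla X Y y h) F x"
        by (rule tensorial_cong[OF tN V(1,2) n[OF vf_scale[OF that(2,1)]]])
          (rule nabla_scale2[OF V(1) that(1) XV that(2)])
      moreover have "\<dots> = X x k *\<^sub>R snabla Y F x + k x *\<^sub>R snabla (nabla X Y) F x"
        using tensorial_add[OF tN V(1,2) vf_scale[OF that(2) vf_apply[OF XV V(1) that(1)]]
            vf_scale[OF n[OF that(2)] that(1)]]
          tensorial_scale[OF tN V(1,2) vf_apply[OF XV V(1) that(1)] that(2)]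
          tensorial_scale[OF tN V(1,2) that(1) n[OF that(2)]]
        by simp
      ultimately show ?thesis
        using snabla_scale[OF V(1) VU XV V(2) that(1) snabla_sv[OF V(1) VU that(2) FV]]
        by (simp add: scaleR_diff_right)
    qed
    show "snabla X (snabla Y F) x - snabla (nabla X Y) F x = snabla X (snabla Z F) x - snabla (nabla X Z) F x"
      if *: "vf V Y" "\<And>y. y \<in> V \<Longrightarrow> Y y = Z y" for Y Z
    proof -
      have "snabla X (snabla Y F) x = snabla X (snabla Z F) x"
        by (rule snabla_cong[OF V(1) VU XV V(2) snabla_sv[OF V(1) VU *(1) FV]])
          (rule tensorial_cong[OF tNV V(1) _ *])
      moreover have "snabla (nabla X Y) F x = snabla (nabla X Z) F x"
        by (rule tensorial_cong[OF tN V(1,2) n[OF *(1)]])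
          (use nabla_cong[OF V(1) XV *(1), of X Z] *(2) in simp)
      ultimately show ?thesis by simp
    qed
  qed
qed

lemma tensorial_at_linear:
  assumes "linear L" "tensorial_at x B"
  shows "tensorial_at x (\<lambda>X. L (B X))"
proof (rule tensorial_atI[OF open_UNIV UNIV_I])
  fix V assume V: "open V" "x \<in> V"
  note t = tensorial_add[OF assms(2) V] tensorial_scale[OF assms(2) V] tensorial_cong[OF assms(2) V]
  show "L (B (\<lambda>y h. X y h + Y y h)) = L (B X) + L (B Y)" if "vf V X" "vf V Y" for X Y
    by (simp add: t(1)[OF that] linear_add[OF assms(1)])
  show "L (B (\<lambda>y h. k y * X y h)) = k x *\<^sub>R L (B X)" if "sf V k" "vf V X" for k X
    by (simp add: t(2)[OF that] linear_scale[OF assms(1)])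
  show "L (B X) = L (B Y)" if "vf V X" "\<And>y. y \<in> V \<Longrightarrow> X y = Y y" for X Y
    using t(3)[OF that] by simp
qed

section \<open>The operators as sums over the frame\<close>

lemma clifford_vec_mult: "clifford_vec \<gamma> v *v w = (\<Sum>a\<in>UNIV. (v $ a) *\<^sub>R (\<gamma> a *v w))"
  by (simp add: clifford_vec_def vec_eq_iff matrix_vector_mult_def sum_distrib_right scaleR_sum_right)
    (intro allI sum.swap)

lemma clifford_mult_eq:
  "E i = e \<Longrightarrow> clifford_mult g \<gamma> E X \<psi> i x = (\<Sum>a\<in>UNIV. g x (X x) (e a x) *\<^sub>R (\<gamma> a *v \<psi> i x))"
  by (simp add: clifford_mult_def clifford_vec_mult)

lemma meet_frame:
  assumes "open W" "x \<in> W" "x \<in> U"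
  shows "open (W \<inter> U)" "W \<inter> U \<subseteq> U" "x \<in> W \<inter> U"
  using assms frame_open by auto

lemma dirac_eq:
  assumes E: "E i = e" and x: "x \<in> U"
  shows "dirac \<A> g nabla \<gamma> E \<psi> i x = (\<Sum>a\<in>UNIV. \<gamma> a *v snabla (e a) (\<psi> i) x)"
proof -
  have "dirac \<A> g nabla \<gamma> E \<psi> i x =
      (\<Sum>a\<in>UNIV. clifford_mult g \<gamma> E (e a) (spin_connection g nabla \<gamma> E (e a) \<psi>) i x)"
    unfolding dirac_def
  proof (rule metric_trace_eq[OF x]; unfold clifford_mult_eq[of E i, OF E] spin_connection_eq[of E i, OF E])
    fix W X assume W: "open W" "x \<in> W" and X: "vf W X"
    have lin: "linear (\<lambda>t. t *\<^sub>R w)" for w :: "complex ^ 's"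
      by (rule linearI) (simp_all add: scaleR_add_left)
    show "tensorial_at x (\<lambda>Y. \<Sum>a\<in>UNIV. g x (Y x) (e a x) *\<^sub>R (\<gamma> a *v snabla X (\<psi> i) x))"
      by (intro tensorial_at_sum tensorial_at_linear[OF lin] tensorial_g frame_T x)
    have lin': "linear (\<lambda>v. t *\<^sub>R (\<gamma> a *v v))" for t a
      by (rule linearI) (simp_all add: G_add G_scaleR scaleR_add_right)
    show "tensorial_at x (\<lambda>Y. \<Sum>a\<in>UNIV. g x (X x) (e a x) *\<^sub>R (\<gamma> a *v snabla Y (\<psi> i) x))"
      by (intro tensorial_at_sum tensorial_at_linear[OF lin'] tensorial_snabla[OF frame_open order_refl x])
  qed
  then show ?thesis
    by (simp add: clifford_mult_eq[of E i, OF E] spin_connection_eq[of E i, OF E] frame_orthonormal[OF x]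
        if_distrib[of "\<lambda>t. t *\<^sub>R _"] cong: if_cong)
qed

lemma spinor_laplacian_eq:
  assumes E: "E i = e" and x: "x \<in> U" and \<psi>: "sv U (\<psi> i)"
  shows "spinor_laplacian \<A> g nabla \<gamma> E \<psi> i x =
    (\<Sum>a\<in>UNIV. snabla (e a) (snabla (e a) (\<psi> i)) x - snabla (nabla (e a) (e a)) (\<psi> i) x)"
proof -
  have hess: "spinor_hessian g nabla \<gamma> E \<psi> X Y i x = snabla X (snabla Y (\<psi> i)) x - snabla (nabla X Y) (\<psi> i) x" for X Y
  proof -
    have "spin_connection g nabla \<gamma> E Y \<psi> i = snabla Y (\<psi> i)"
      using spin_connection_eq[of E i, OF E] by blast
    then show ?thesis unfolding spinor_hessian_def spin_connection_eq[of E i, OF E] by simp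
  qed
  show ?thesis
    unfolding spinor_laplacian_def hess
  proof (rule metric_trace_eq[OF x])
    fix W X assume W: "open W" "x \<in> W" and X: "vf W X"
    note m = meet_frame[OF W x]
    note X' = vf_subset[OF X Int_lower1[of W U]] and F' = sv_subset[OF \<psi> m(2)]
    show "tensorial_at x (\<lambda>Y. snabla Y (snabla X (\<psi> i)) x - snabla (nabla Y X) (\<psi> i) x)"
      "tensorial_at x (\<lambda>Y. snabla X (snabla Y (\<psi> i)) x - snabla (nabla X Y) (\<psi> i) x)"
      by (rule tensorial_spinor_hessian[OF m X' F'])+
  qed
qed

section \<open>The square of the weighted Dirac operator in one trivialisation\<close>

definition local_dirac :: "('m \<Rightarrow> real) \<Rightarrow> ('m \<Rightarrow> complex ^ 's) \<Rightarrow> 'm \<Rightarrow> complex ^ 's" where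
  "local_dirac f F x = (\<Sum>a\<in>UNIV. \<gamma> a *v snabla (e a) F x) - (1 / 2) *\<^sub>R (\<Sum>a\<in>UNIV. e a x f *\<^sub>R (\<gamma> a *v F x))"

lemma weighted_dirac_eq:
  "E i = e \<Longrightarrow> x \<in> U \<Longrightarrow> weighted_dirac \<A> g nabla \<gamma> E f \<psi> i x = local_dirac f (\<psi> i) x"
  by (simp add: weighted_dirac_def local_dirac_def dirac_eq clifford_mult_eq g_gradient)

text \<open>\<open>D\<close> is only required to agree with \<open>local_dirac f F\<close> on
  \<open>U\<close>: this is what is known of a globally defined Dirac field, and on an open set it
  suffices for differentiation.\<close>

lemma local_dirac_local_dirac:
  assumes x: "x \<in> U" and f: "sf U f" and F: "sv U F"
    and D: "\<And>y. y \<in> U \<Longrightarrow> D y = local_dirac f F y"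
  shows "local_dirac f D x =
    - ((\<Sum>a\<in>UNIV. snabla (e a) (snabla (e a) F) x - snabla (nabla (e a) (e a)) F x) - snabla (gradient \<A> g f) F x)
    + (1 / 4 * weighted_scalar_curvature \<A> g nabla f x) *\<^sub>R F x"
proof -
  note o = frame_open and vf = frame_vf
  note Nsv = snabla_sv[OF o order_refl vf] and T = vf_T[OF vf x]
  define w where "w c d b = \<omega> (e c) d b x" for c d b
  define p where "p d = snabla (e d) F x" for d
  define q where "q c d = snabla (e c) (snabla (e d) F) x" for c d
  define u where "u d = e d x f" for d
  define H where "H c d = hessian nabla f (e c) (e d) x" for c d
  define R where "R c d a b = g x (curvature \<A> nabla (e c) (e d) (e a) x) (e b x)" for c d a b
  interpret clifford_curvature "\<lambda>a v. \<gamma> a *v v" R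
    using clifford_action_axioms algebraic_curvature[OF x]
    unfolding clifford_curvature_def R_def[abs_def] by blast
  have anti: "w c d b = - w c b d" for c d b
    unfolding w_def by (rule omega_antisym[OF o order_refl vf x])
  have nabla_e: "nabla (e c) (e d) x = (\<lambda>h. \<Sum>b\<in>UNIV. w c d b * e b x h)" for c d
    using frame_expand[OF x nabla_frame_T[OF o order_refl vf x]] by (simp add: w_def \<omega>_def)
  have snabla_frame: "snabla (nabla (e c) (e d)) F x = (\<Sum>b\<in>UNIV. w c d b *\<^sub>R p b)" for c d
    using tensorial_expand[OF tensorial_snabla[OF o order_refl x] o x order_refl nabla_vf[OF o vf vf]]
    by (simp add: w_def \<omega>_def p_def)
  have snabla_grad: "snabla (gradient \<A> g f) F x = (\<Sum>b\<in>UNIV. u b *\<^sub>R p b)"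
    using tensorial_expand[OF tensorial_snabla[OF o order_refl x] o x order_refl gradient_vf[OF f]]
    by (simp add: g_gradient[OF x] u_def p_def)
  have comm: "q c d - q d c - (\<Sum>b\<in>UNIV. (w c d b - w d c b) *\<^sub>R p b) = spin_action (R c d) (F x)" for c d
  proof -
    have "snabla (lie_bracket \<A> (e c) (e d)) F x = (\<Sum>b\<in>UNIV. (w c d b - w d c b) *\<^sub>R p b)"
    proof -
      have "g x (lie_bracket \<A> (e c) (e d) x) (e b x) = w c d b - w d c b" for b
        unfolding lie_bracket_frame[OF x] w_def
        by (simp add: g_sum T_scale T g_scale frame_orthonormal[OF x] if_distrib[of "(*) _"] cong: if_cong)
      then show ?thesis
        using tensorial_expand[OF tensorial_snabla[OF o order_refl x] o x order_refl lie_bracket_vf[OF o vf vf]]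
        by (simp add: p_def)
    qed
    then show ?thesis
      using snabla_commutator[OF o order_refl vf vf F x, of c d] by (simp add: q_def R_def[abs_def])
  qed
  have H: "H c d = e c x (\<lambda>y. e d y f) - (\<Sum>b\<in>UNIV. w c d b * u b)" for c d
    by (simp add: H_def hessian_def nabla_e u_def)
  have H_sym: "H c d = H d c" for c d
    unfolding H_def by (rule hessian_symmetric[OF o x vf vf f])
  have scal: "weighted_scalar_curvature \<A> g nabla f x =
      (\<Sum>a\<in>UNIV. \<Sum>b\<in>UNIV. R b a a b) + 2 * (\<Sum>c\<in>UNIV. H c c) - (\<Sum>c\<in>UNIV. (u c)\<^sup>2)"
    by (simp add: weighted_scalar_curvature_def scalar_curvature_eq[OF x] laplacian_eq[OF x f]
        norm_gradient[OF x] R_def H_def u_def)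
  have s1: "sv U (\<lambda>y. \<gamma> a *v snabla (e a) F y)" for a
    by (rule sv_mult[OF o Nsv[OF F]])
  have s2: "sv U (\<lambda>y. e a y f *\<^sub>R (\<gamma> a *v F y))" for a
    by (rule sv_scale[OF o vf_apply[OF vf o f] sv_mult[OF o F]])
  note s3 = sv_sum[OF o s1, where I=UNIV] and s4 = sv_sum[OF o s2, where I=UNIV]
  note s5 = sv_scale[OF o sf_const s4, of "1 / 2"]
  have "sv U (local_dirac f F)"
    unfolding local_dirac_def[abs_def] by (rule sv_diff[OF o s3 s5])
  \<comment> \<open>Smoothness of the inner field justifies exchanging it for its frame formula
    under the outer derivative.\<close>
  then have "snabla (e c) D x = snabla (e c) (local_dirac f F) x" for c
    by (rule snabla_cong[OF o order_refl vf x, symmetric]) (simp add: D)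
  also have "snabla (e c) (local_dirac f F) x =
      (\<Sum>d\<in>UNIV. snabla (e c) (\<lambda>y. \<gamma> d *v snabla (e d) F y) x)
      - (1 / 2) *\<^sub>R (\<Sum>d\<in>UNIV. snabla (e c) (\<lambda>y. e d y f *\<^sub>R (\<gamma> d *v F y)) x)" for c
    unfolding local_dirac_def[abs_def]
    by (simp add: snabla_diff[OF o order_refl vf x s3 s5] snabla_scale[OF o order_refl vf x sf_const s4]
        snabla_sum[OF o order_refl vf x s1] snabla_sum[OF o order_refl vf x s2] tvec_const[OF T o x])
  also have "(\<Sum>d\<in>UNIV. snabla (e c) (\<lambda>y. \<gamma> d *v snabla (e d) F y) x) =
      (\<Sum>d\<in>UNIV. (\<Sum>b\<in>UNIV. w c d b *\<^sub>R (\<gamma> b *v p d)) + \<gamma> d *v q c d)" for c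
    by (simp add: snabla_clifford[OF o order_refl vf x Nsv[OF F]] w_def p_def q_def)
  also have "(\<Sum>d\<in>UNIV. snabla (e c) (\<lambda>y. e d y f *\<^sub>R (\<gamma> d *v F y)) x) =
      (\<Sum>d\<in>UNIV. H c d *\<^sub>R (\<gamma> d *v F x) + u d *\<^sub>R (\<gamma> d *v p c))" for c
  proof -
    have "snabla (e c) (\<lambda>y. e d y f *\<^sub>R (\<gamma> d *v F y)) x =
        e c x (\<lambda>y. e d y f) *\<^sub>R (\<gamma> d *v F x)
        + (\<Sum>b\<in>UNIV. (u d * w c d b) *\<^sub>R (\<gamma> b *v F x)) + u d *\<^sub>R (\<gamma> d *v p c)" for d
      by (simp add: snabla_scale[OF o order_refl vf x vf_apply[OF vf o f] sv_mult[OF o F]]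
          snabla_clifford[OF o order_refl vf x F] w_def p_def u_def scaleR_add_right scaleR_sum_right)
    \<comment> \<open>The frame rotation arrives with the indices of \<open>w\<close> exchanged.
      Antisymmetry converts it into the correction term that turns second derivatives of
      \<open>f\<close> into the Hessian \<open>H\<close>.\<close>
    moreover have "(\<Sum>d\<in>UNIV. \<Sum>b\<in>UNIV. (u d * w c d b) *\<^sub>R (\<gamma> b *v F x)) =
        - (\<Sum>d\<in>UNIV. (\<Sum>b\<in>UNIV. w c d b * u b) *\<^sub>R (\<gamma> d *v F x))"
    proof -
      have "(\<Sum>d\<in>UNIV. \<Sum>b\<in>UNIV. (u d * w c d b) *\<^sub>R (\<gamma> b *v F x)) =
          (\<Sum>b\<in>UNIV. \<Sum>d\<in>UNIV. - ((w c b d * u d) *\<^sub>R (\<gamma> b *v F x)))"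
        by (subst sum.swap, intro sum.cong refl, subst anti) simp
      then show ?thesis by (simp add: sum_negf scaleR_sum_left)
    qed
    ultimately show ?thesis
      by (simp add: H sum.distrib sum_subtractf scaleR_diff_left)
  qed
  finally have ND: "snabla (e c) D x =
      (\<Sum>d\<in>UNIV. (\<Sum>b\<in>UNIV. w c d b *\<^sub>R (\<gamma> b *v p d)) + \<gamma> d *v q c d)
      - (1 / 2) *\<^sub>R (\<Sum>d\<in>UNIV. H c d *\<^sub>R (\<gamma> d *v F x) + u d *\<^sub>R (\<gamma> d *v p c))" for c .
  have Dx: "D x = (\<Sum>c\<in>UNIV. \<gamma> c *v p c) - (1 / 2) *\<^sub>R (\<Sum>c\<in>UNIV. u c *\<^sub>R (\<gamma> c *v F x))"
    by (simp add: D[OF x] local_dirac_def p_def u_def)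
  have "local_dirac f D x = - ((\<Sum>c\<in>UNIV. q c c - (\<Sum>b\<in>UNIV. w c c b *\<^sub>R p b)) - (\<Sum>c\<in>UNIV. u c *\<^sub>R p c))
      + (1 / 4 * weighted_scalar_curvature \<A> g nabla f x) *\<^sub>R F x"
    unfolding local_dirac_def ND Dx scal u_def[symmetric]
    by (rule weighted_weitzenboeck[OF anti comm H_sym])
  then show ?thesis
    by (simp add: snabla_frame snabla_grad q_def)
qed

end

theorem proposition2p8:
  fixes \<A> :: "('m::{t2_space, second_countable_topology}, 'n::finite) chart set"
    and g :: "'m metric"
    and nabla :: "'m connection"
    and \<gamma> :: "'n \<Rightarrow> complex ^ 's ^ 's::finite"
    and U :: "'i \<Rightarrow> 'm set"
    and E :: "'i \<Rightarrow> 'n \<Rightarrow> 'm vfield"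
    and \<tau> :: "'i \<Rightarrow> 'i \<Rightarrow> 'm \<Rightarrow> complex ^ 's ^ 's"
    and f :: "'m \<Rightarrow> real"
    and \<psi> :: "('i, 'm, 's) spinor_field"
  assumes "smooth_manifold \<A>"
    and "riemannian_metric \<A> g"
    and "complete_metric \<A> g"
    and "levi_civita \<A> g nabla"
    and "spinor_representation \<gamma>"
    and "spin_structure \<A> g \<gamma> U E \<tau>"
    and "smooth_fun_on \<A> UNIV f"
    and "smooth_spinor \<A> U \<tau> \<psi>"
  shows "\<forall>i. \<forall>x\<in>U i.
    weighted_dirac \<A> g nabla \<gamma> E f (weighted_dirac \<A> g nabla \<gamma> E f \<psi>) i x =
      - weighted_spinor_laplacian \<A> g nabla \<gamma> E f \<psi> i x
      + (1 / 4 * weighted_scalar_curvature \<A> g nabla f x) *\<^sub>R \<psi> i x"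
proof (intro allI ballI)
  fix i x assume x: "x \<in> U i"
  have "orthonormal_frame \<A> g (U i) (E i)"
    using assms(6) unfolding spin_structure_def by blast
  then interpret spin_framed_mfd \<A> g nabla "U i" "E i" \<gamma>
    using assms by unfold_locales
  have \<psi>: "sv (U i) (\<psi> i)"
    using assms(8) unfolding smooth_spinor_def sv_def by blast
  have f: "smooth_fun_on \<A> (U i) f"
    using smooth_fun_on_subset[OF assms(7)] by blast
  show "weighted_dirac \<A> g nabla \<gamma> E f (weighted_dirac \<A> g nabla \<gamma> E f \<psi>) i x =
      - weighted_spinor_laplacian \<A> g nabla \<gamma> E f \<psi> i x
      + (1 / 4 * weighted_scalar_curvature \<A> g nabla f x) *\<^sub>R \<psi> i x"
    \<comment> \<open>The inner operator is identified on all of \<open>U i\<close>, since it gets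
      differentiated; for the outer one the value at \<open>x\<close> is enough.\<close>
    using local_dirac_local_dirac[OF x f \<psi>, of "weighted_dirac \<A> g nabla \<gamma> E f \<psi> i",
        OF weighted_dirac_eq[of E i, OF refl]]
    by (simp add: weighted_dirac_eq[of E i x, OF refl x] weighted_spinor_laplacian_def
        spinor_laplacian_eq[of E i x \<psi>, OF refl x \<psi>] spin_connection_eq[of E i, OF refl])
qed

end
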